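(* Let $X=(X,\varepsilon(X))$ be an exterior space and suppose that $X$ is locally path-connected and locally compact at infinity. Then: (i) $L(X)=\bar L(X)$ is compact; (ii) $e_0L(X)=\bar e_0\bar L(X)=eL(X)=\bar e\bar L(X)=\check{\pi}_0(X)=\check{\bar\pi}_0(X)=\check c(X)=\check{\bar c}(X)$ (any end point is representable by a point of the limit); (iii) $\check{\pi}_0(X)=\check{\bar\pi}_0(X)=\check c(X)=\check{\bar c}(X)$ is a profinite compact space; (iv) if $a\in\check{\pi}_0(X)=\check{\bar\pi}_0(X)=\check c(X)=\check{\bar c}(X)$, then $L_a(X)=\bar L_a(X)=L^0_a(X)=\bar L^0_a(X)$ is a non-empty continuum. Here equalities of end spaces mean that the canonical natural maps between them are homeomorphisms, under which the indicated subsets correspond.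
   Context: An externology on a topological space $X$ is a non-empty collection $\varepsilon(X)$ of open subsets closed under finite intersections and such that any open set containing a member of $\varepsilon(X)$ is in $\varepsilon(X)$. An exterior space is a topological space with an externology. It is locally compact at infinity if for every $E\in\varepsilon(X)$ there is $E'\in\varepsilon(X)$ such that $\overline{E'}$ is compact and $\overline{E'}\subset E$. For a space $Y$, $\pi_0(Y)$ (resp. $c(Y)$) is the set of path-components (resp. connected components) with the quotient topology from $Y$. Regarding $\varepsilon(X)$ and $\{\overline{E}: E\in\varepsilon(X)\}$ as inverse systems under inclusions, define $L(X)=\bigcap_{E\in\varepsilon(X)}E$, $\bar L(X)=\bigcap_{E\in\varepsilon(X)}\overline{E}$ (subspaces of $X$), and the inverse limits in topological spaces $\check{\pi}_0(X)=\lim_{E}\pi_0(E)$, $\check c(X)=\lim_{E}c(E)$, $\check{\bar\pi}_0(X)=\lim_{E}\pi_0(\overline{E})$, $\check{\bar c}(X)=\lim_{E}c(\overline{E})$, $E\in\varepsilon(X)$. The inclusions $E\subset\overline{E}$ and the natural maps $\pi_0(Y)\to c(Y)$ induce the canonical maps $\check{\pi}_0(X)\to\check{\bar\pi}_0(X)$, $\check c(X)\to\check{\bar c}(X)$, $\check{\pi}_0(X)\to\check c(X)$, $\check{\bar\pi}_0(X)\to\check{\bar c}(X)$. The maps $e_0:L(X)\to\check{\pi}_0(X)$, $e:L(X)\to\check c(X)$, $\bar e_0:\bar L(X)\to\check{\bar\pi}_0(X)$, $\bar e:\bar L(X)\to\check{\bar c}(X)$ send $p$ to the family of (path-)components of $E$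 (resp. $\overline{E}$) containing $p$; $e_0L(X)$, $eL(X)$, $\bar e_0\bar L(X)$, $\bar e\bar L(X)$ denote their images. For an end point $a$ of the corresponding end space, $L^0_a(X)=e_0^{-1}(a)$, $L_a(X)=e^{-1}(a)$, $\bar L^0_a(X)=\bar e_0^{-1}(a)$, $\bar L_a(X)=\bar e^{-1}(a)$.
   Formalization: In (iv), that the fibre is a continuum is proved assuming the closure of some member of the externology is Hausdorff (automatic if X is Hausdorff); otherwise it fails: in the line with two origins, with the open sets containing both, the single fibre is a discrete two-point set. *)

theory Defs
  imports "HOL-Analysis.Analysis"
begin

section \<open>Exterior spaces\<close>

definition externology :: "'a topology \<Rightarrow> 'a set set \<Rightarrow> bool" where
  "externology X \<epsilon> \<longleftrightarrow>
     \<epsilon> \<noteq> {} \<and>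
     (\<forall>E\<in>\<epsilon>. openin X E) \<and>
     (\<forall>E\<in>\<epsilon>. \<forall>F\<in>\<epsilon>. E \<inter> F \<in> \<epsilon>) \<and>
     (\<forall>E\<in>\<epsilon>. \<forall>U. openin X U \<and> E \<subseteq> U \<longrightarrow> U \<in> \<epsilon>)"

definition locally_compact_at_infinity :: "'a topology \<Rightarrow> 'a set set \<Rightarrow> bool" where
  "locally_compact_at_infinity X \<epsilon> \<longleftrightarrow>
     (\<forall>E\<in>\<epsilon>. \<exists>E'\<in>\<epsilon>. compactin X (X closure_of E') \<and> X closure_of E' \<subseteq> E)"

text \<open>This holds if \<open>X\<close> is Hausdorff, and also if \<open>\<epsilon>\<close> is locally compact at infinity with
  ``compact'' understood to include the Hausdorff axiom. Without it the fibres over end points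
  need not be connected: in the line with two origins, let \<open>\<epsilon>\<close> consist of the open sets containing
  both origins. There is a single end, and its fibre is the discrete set of the two origins.\<close>

definition Hausdorff_at_infinity :: "'a topology \<Rightarrow> 'a set set \<Rightarrow> bool" where
  "Hausdorff_at_infinity X \<epsilon> \<longleftrightarrow> (\<exists>E\<in>\<epsilon>. Hausdorff_space (subtopology X (X closure_of E)))"

definition continuum_in :: "'a topology \<Rightarrow> 'a set \<Rightarrow> bool" where
  "continuum_in X S \<longleftrightarrow>
     compactin X S \<and> connectedin X S \<and> Hausdorff_space (subtopology X S)"

section \<open>Spaces of components\<close>

definition quotient_topology :: "'a topology \<Rightarrow> ('a \<Rightarrow> 'b) \<Rightarrow> 'b topology" where
  "quotient_topology Y q =
     topology (\<lambda>V. V \<subseteq> q ` topspace Y \<and> openin Y {y \<in> topspace Y. q y \<in> V})"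

lemma openin_quotient_topology:
  "openin (quotient_topology Y q) V \<longleftrightarrow>
     V \<subseteq> q ` topspace Y \<and> openin Y {y \<in> topspace Y. q y \<in> V}"
proof -
  let ?P = "\<lambda>V. V \<subseteq> q ` topspace Y \<and> openin Y {y \<in> topspace Y. q y \<in> V}"
  have "istopology ?P"
    unfolding istopology_def
  proof (intro conjI allI impI)
    fix S T assume S: "?P S" and T: "?P T"
    have "{y \<in> topspace Y. q y \<in> S \<inter> T} =
        {y \<in> topspace Y. q y \<in> S} \<inter> {y \<in> topspace Y. q y \<in> T}"
      by auto
    with S T show "openin Y {y \<in> topspace Y. q y \<in> S \<inter> T}"
      by (metis (no_types, lifting) openin_Int)
    from S show "S \<inter> T \<subseteq> q ` topspace Y" by auto
  next
    fix \<K> assume K: "\<forall>K\<in>\<K>. ?P K"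
    have "{y \<in> topspace Y. q y \<in> \<Union>\<K>} = (\<Union>K\<in>\<K>. {y \<in> topspace Y. q y \<in> K})"
      by auto
    with K show "openin Y {y \<in> topspace Y. q y \<in> \<Union>\<K>}"
      by auto
    from K show "\<Union>\<K> \<subseteq> q ` topspace Y" by auto
  qed
  then show ?thesis
    by (simp add: quotient_topology_def)
qed

lemma topspace_quotient_topology [simp]: "topspace (quotient_topology Y q) = q ` topspace Y"
proof (rule antisym)
  show "topspace (quotient_topology Y q) \<subseteq> q ` topspace Y"
    using openin_quotient_topology [of Y q "topspace (quotient_topology Y q)"] by simp
  have "{y \<in> topspace Y. q y \<in> q ` topspace Y} = topspace Y" by auto
  then have "openin (quotient_topology Y q) (q ` topspace Y)"
    by (simp add: openin_quotient_topology)
  then show "q ` topspace Y \<subseteq> topspace (quotient_topology Y q)"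
    by (rule openin_subset)
qed

lemma quotient_map_quotient_topology: "quotient_map Y (quotient_topology Y q) q"
  by (auto simp: quotient_map_def openin_quotient_topology)

definition pi0_space :: "'a topology \<Rightarrow> 'a set topology" where
  "pi0_space Y = quotient_topology Y (path_component_of_set Y)"

definition c_space :: "'a topology \<Rightarrow> 'a set topology" where
  "c_space Y = quotient_topology Y (connected_component_of_set Y)"

lemma topspace_pi0_space: "topspace (pi0_space Y) = path_components_of Y"
  by (simp add: pi0_space_def path_components_of_def)

lemma topspace_c_space: "topspace (c_space Y) = connected_components_of Y"
  by (simp add: c_space_def connected_components_of_def)

text \<open>If \<open>C\<close> is a non-empty (path-)connected subset of \<open>Z\<close>, all the sets in the unions below
  coincide, so these maps send \<open>C\<close> to the (path-)component of \<open>Z\<close> containing it. Hence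
  \<open>pi0_map Z\<close> is the map \<open>\<pi>\<^sub>0(Y) \<rightarrow> \<pi>\<^sub>0(Z)\<close> induced by an inclusion of \<open>Y\<close> in \<open>Z\<close>, and
  \<open>c_map Z\<close> is both the map \<open>c(Y) \<rightarrow> c(Z)\<close> induced by such an inclusion and the natural map
  \<open>\<pi>\<^sub>0(Z) \<rightarrow> c(Z)\<close>.\<close>

definition pi0_map :: "'a topology \<Rightarrow> 'a set \<Rightarrow> 'a set" where
  "pi0_map Z C = (\<Union>y\<in>C. path_component_of_set Z y)"

definition c_map :: "'a topology \<Rightarrow> 'a set \<Rightarrow> 'a set" where
  "c_map Z C = (\<Union>y\<in>C. connected_component_of_set Z y)"

lemma pi0_map_eq:
  assumes "path_connectedin Z C" "y \<in> C"
  shows "pi0_map Z C = path_component_of_set Z y"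
proof -
  have *: "path_component_of Z y z" if "z \<in> C" for z
    using assms that path_component_of_maximal by fastforce
  then have "path_component_of_set Z z = path_component_of_set Z y" if "z \<in> C" for z
    using that * path_component_of_equiv by metis
  with assms(2) show ?thesis
    unfolding pi0_map_def by blast
qed

lemma c_map_eq:
  assumes "connectedin Z C" "y \<in> C"
  shows "c_map Z C = connected_component_of_set Z y"
proof -
  have *: "connected_component_of Z y z" if "z \<in> C" for z
    using assms that connected_component_of_maximal by fastforce
  then have "connected_component_of_set Z z = connected_component_of_set Z y" if "z \<in> C" for z
    using that * connected_component_of_equiv by metis
  with assms(2) show ?thesis
    unfolding c_map_def by blast
qed

section \<open>Inverse limits and profinite spaces\<close>

text \<open>\<open>le i j\<close> means that \<open>j\<close> lies beyond \<open>i\<close>, and \<open>f i j\<close> is the bonding map from \<open>T j\<close>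
  to \<open>T i\<close>.\<close>

definition inverse_system ::
    "'i set \<Rightarrow> ('i \<Rightarrow> 'i \<Rightarrow> bool) \<Rightarrow> ('i \<Rightarrow> 'b topology) \<Rightarrow> ('i \<Rightarrow> 'i \<Rightarrow> 'b \<Rightarrow> 'b) \<Rightarrow> bool" where
  "inverse_system I le T f \<longleftrightarrow>
     I \<noteq> {} \<and>
     (\<forall>i\<in>I. le i i) \<and>
     (\<forall>i\<in>I. \<forall>j\<in>I. \<forall>k\<in>I. le i j \<and> le j k \<longrightarrow> le i k) \<and>
     (\<forall>i\<in>I. \<forall>j\<in>I. \<exists>k\<in>I. le i k \<and> le j k) \<and>
     (\<forall>i\<in>I. \<forall>j\<in>I. le i j \<longrightarrow> continuous_map (T j) (T i) (f i j)) \<and>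
     (\<forall>i\<in>I. \<forall>x\<in>topspace (T i). f i i x = x) \<and>
     (\<forall>i\<in>I. \<forall>j\<in>I. \<forall>k\<in>I. le i j \<and> le j k \<longrightarrow>
        (\<forall>x\<in>topspace (T k). f i j (f j k x) = f i k x))"

definition inverse_limit ::
    "'i set \<Rightarrow> ('i \<Rightarrow> 'i \<Rightarrow> bool) \<Rightarrow> ('i \<Rightarrow> 'b topology) \<Rightarrow> ('i \<Rightarrow> 'i \<Rightarrow> 'b \<Rightarrow> 'b) \<Rightarrow> ('i \<Rightarrow> 'b) topology"
  where
  "inverse_limit I le T f =
     subtopology (product_topology T I)
       {x. \<forall>i\<in>I. \<forall>j\<in>I. le i j \<longrightarrow> f i j (x j) = x i}"

text \<open>Profinite: an inverse limit of finite discrete spaces. Fixing the types of the indices and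
  of the points of the finite spaces loses no generality: an inverse limit \<open>T\<close> of finite discrete
  spaces is the limit of its finite partitions into open sets, and these have indices of type
  \<^typ>\<open>'b set set\<close> and points of type \<^typ>\<open>'b set\<close>.\<close>

definition profinite_space :: "'b topology \<Rightarrow> bool" where
  "profinite_space T \<longleftrightarrow>
     (\<exists>(I :: 'b set set set) le (D :: 'b set set \<Rightarrow> 'b set set) f.
        (\<forall>i\<in>I. finite (D i)) \<and>
        inverse_system I le (\<lambda>i. discrete_topology (D i)) f \<and>
        T homeomorphic_space inverse_limit I le (\<lambda>i. discrete_topology (D i)) f)"

section \<open>Limit spaces and end spaces\<close>

definition limit_set :: "'a topology \<Rightarrow> 'a set set \<Rightarrow> 'a set" where
  "limit_set X \<epsilon> = (\<Inter>E\<in>\<epsilon>. E)"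

definition bar_limit_set :: "'a topology \<Rightarrow> 'a set set \<Rightarrow> 'a set" where
  "bar_limit_set X \<epsilon> = (\<Inter>E\<in>\<epsilon>. X closure_of E)"

text \<open>In each of the four names below, \<open>bar\<close> refers to the system of closures, which is indexed
  by the members \<open>E\<close> of \<open>\<epsilon>\<close> themselves.\<close>

definition pi0_ends :: "'a topology \<Rightarrow> 'a set set \<Rightarrow> ('a set \<Rightarrow> 'a set) topology" where
  "pi0_ends X \<epsilon> =
     inverse_limit \<epsilon> (\<lambda>E F. F \<subseteq> E)
       (\<lambda>E. pi0_space (subtopology X E))
       (\<lambda>E F. pi0_map (subtopology X E))"

definition bar_pi0_ends :: "'a topology \<Rightarrow> 'a set set \<Rightarrow> ('a set \<Rightarrow> 'a set) topology" where
  "bar_pi0_ends X \<epsilon> =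
     inverse_limit \<epsilon> (\<lambda>E F. F \<subseteq> E)
       (\<lambda>E. pi0_space (subtopology X (X closure_of E)))
       (\<lambda>E F. pi0_map (subtopology X (X closure_of E)))"

definition c_ends :: "'a topology \<Rightarrow> 'a set set \<Rightarrow> ('a set \<Rightarrow> 'a set) topology" where
  "c_ends X \<epsilon> =
     inverse_limit \<epsilon> (\<lambda>E F. F \<subseteq> E)
       (\<lambda>E. c_space (subtopology X E))
       (\<lambda>E F. c_map (subtopology X E))"

definition bar_c_ends :: "'a topology \<Rightarrow> 'a set set \<Rightarrow> ('a set \<Rightarrow> 'a set) topology" where
  "bar_c_ends X \<epsilon> =
     inverse_limit \<epsilon> (\<lambda>E F. F \<subseteq> E)
       (\<lambda>E. c_space (subtopology X (X closure_of E)))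
       (\<lambda>E F. c_map (subtopology X (X closure_of E)))"

lemma inverse_system_pi0:
  assumes ext: "externology X \<epsilon>" and mono: "\<And>E F. F \<subseteq> E \<Longrightarrow> A F \<subseteq> A E"
  shows "inverse_system \<epsilon> (\<lambda>E F. F \<subseteq> E)
           (\<lambda>E. pi0_space (subtopology X (A E))) (\<lambda>E F. pi0_map (subtopology X (A E)))"
proof -
  have val: "pi0_map (subtopology X (A E)) (path_component_of_set (subtopology X (A F)) y)
      = path_component_of_set (subtopology X (A E)) y"
    if "F \<subseteq> E" "y \<in> topspace (subtopology X (A F))" for E F y
  proof (rule pi0_map_eq)
    show "path_connectedin (subtopology X (A E)) (path_component_of_set (subtopology X (A F)) y)"
      using path_connectedin_path_component_of [of "subtopology X (A F)" y] mono [OF that(1)]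
      by (auto simp: path_connectedin_subtopology)
    show "y \<in> path_component_of_set (subtopology X (A F)) y"
      using that(2) by (simp add: path_component_of_refl)
  qed
  have "continuous_map (pi0_space (subtopology X (A F))) (pi0_space (subtopology X (A E)))
      (pi0_map (subtopology X (A E)))" if FE: "F \<subseteq> E" for E F
  proof -
    let ?Y = "subtopology X (A F)" and ?Z = "subtopology X (A E)"
    have "continuous_map ?Y (pi0_space ?Z) (path_component_of_set ?Z)"
      unfolding pi0_space_def
      using mono [OF FE] quotient_imp_continuous_map [OF quotient_map_quotient_topology]
        continuous_map_from_subtopology_mono by blast
    then have "continuous_map ?Y (pi0_space ?Z) (pi0_map ?Z \<circ> path_component_of_set ?Y)"
      by (rule continuous_map_eq) (use val [OF FE] in simp)
    then show ?thesis
      unfolding pi0_space_def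
      using continuous_compose_quotient_map quotient_map_quotient_topology by blast
  qed
  moreover have "\<exists>k\<in>\<epsilon>. k \<subseteq> E \<and> k \<subseteq> F" if "E \<in> \<epsilon>" "F \<in> \<epsilon>" for E F
    using ext that unfolding externology_def by (meson Int_lower1 Int_lower2)
  moreover have "\<epsilon> \<noteq> {}"
    using ext by (simp add: externology_def)
  moreover have "pi0_map (subtopology X (A E)) C = C"
    if "C \<in> topspace (pi0_space (subtopology X (A E)))" for E C
    using that val [of E E] by (auto simp: pi0_space_def)
  moreover have "pi0_map (subtopology X (A E)) (pi0_map (subtopology X (A F)) C)
      = pi0_map (subtopology X (A E)) C"
    if FE: "F \<subseteq> E" and GF: "G \<subseteq> F" and C0: "C \<in> topspace (pi0_space (subtopology X (A G)))" for E F G C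
  proof -
    obtain y where y: "y \<in> topspace (subtopology X (A G))"
      and C: "C = path_component_of_set (subtopology X (A G)) y"
      using C0 by (auto simp: pi0_space_def)
    have "y \<in> topspace (subtopology X (A F))"
      using y mono [OF GF] by auto
    then show ?thesis
      using val [OF GF y] val [OF FE] val [of G E y] FE GF y C by simp
  qed
  ultimately show ?thesis
    unfolding inverse_system_def by (auto intro: subset_trans)
qed

lemma inverse_system_c:
  assumes ext: "externology X \<epsilon>" and mono: "\<And>E F. F \<subseteq> E \<Longrightarrow> A F \<subseteq> A E"
  shows "inverse_system \<epsilon> (\<lambda>E F. F \<subseteq> E)
           (\<lambda>E. c_space (subtopology X (A E))) (\<lambda>E F. c_map (subtopology X (A E)))"
proof -
  have val: "c_map (subtopology X (A E)) (connected_component_of_set (subtopology X (A F)) y)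
      = connected_component_of_set (subtopology X (A E)) y"
    if "F \<subseteq> E" "y \<in> topspace (subtopology X (A F))" for E F y
  proof (rule c_map_eq)
    show "connectedin (subtopology X (A E)) (connected_component_of_set (subtopology X (A F)) y)"
      using connectedin_connected_component_of [of "subtopology X (A F)" y] mono [OF that(1)]
      by (auto simp: connectedin_subtopology)
    show "y \<in> connected_component_of_set (subtopology X (A F)) y"
      using that(2) by (simp add: connected_component_of_refl)
  qed
  have "continuous_map (c_space (subtopology X (A F))) (c_space (subtopology X (A E)))
      (c_map (subtopology X (A E)))" if FE: "F \<subseteq> E" for E F
  proof -
    let ?Y = "subtopology X (A F)" and ?Z = "subtopology X (A E)"
    have "continuous_map ?Y (c_space ?Z) (connected_component_of_set ?Z)"
      unfolding c_space_def
      using mono [OF FE] quotient_imp_continuous_map [OF quotient_map_quotient_topology]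
        continuous_map_from_subtopology_mono by blast
    then have "continuous_map ?Y (c_space ?Z) (c_map ?Z \<circ> connected_component_of_set ?Y)"
      by (rule continuous_map_eq) (use val [OF FE] in simp)
    then show ?thesis
      unfolding c_space_def
      using continuous_compose_quotient_map quotient_map_quotient_topology by blast
  qed
  moreover have "\<exists>k\<in>\<epsilon>. k \<subseteq> E \<and> k \<subseteq> F" if "E \<in> \<epsilon>" "F \<in> \<epsilon>" for E F
    using ext that unfolding externology_def by (meson Int_lower1 Int_lower2)
  moreover have "\<epsilon> \<noteq> {}"
    using ext by (simp add: externology_def)
  moreover have "c_map (subtopology X (A E)) C = C"
    if "C \<in> topspace (c_space (subtopology X (A E)))" for E C
    using that val [of E E] by (auto simp: c_space_def)
  moreover have "c_map (subtopology X (A E)) (c_map (subtopology X (A F)) C)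
      = c_map (subtopology X (A E)) C"
    if FE: "F \<subseteq> E" and GF: "G \<subseteq> F" and C0: "C \<in> topspace (c_space (subtopology X (A G)))" for E F G C
  proof -
    obtain y where y: "y \<in> topspace (subtopology X (A G))"
      and C: "C = connected_component_of_set (subtopology X (A G)) y"
      using C0 by (auto simp: c_space_def)
    have "y \<in> topspace (subtopology X (A F))"
      using y mono [OF GF] by auto
    then show ?thesis
      using val [OF GF y] val [OF FE] val [of G E y] FE GF y C by simp
  qed
  ultimately show ?thesis
    unfolding inverse_system_def by (auto intro: subset_trans)
qed

section \<open>Canonical maps\<close>

text \<open>Points of an end space are extensional functions on \<open>\<epsilon>\<close>, hence the restrictions.\<close>

definition pi0_to_bar_pi0 :: "'a topology \<Rightarrow> 'a set set \<Rightarrow> ('a set \<Rightarrow> 'a set) \<Rightarrow> 'a set \<Rightarrow> 'a set" where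
  "pi0_to_bar_pi0 X \<epsilon> a = (\<lambda>E\<in>\<epsilon>. pi0_map (subtopology X (X closure_of E)) (a E))"

definition c_to_bar_c :: "'a topology \<Rightarrow> 'a set set \<Rightarrow> ('a set \<Rightarrow> 'a set) \<Rightarrow> 'a set \<Rightarrow> 'a set" where
  "c_to_bar_c X \<epsilon> a = (\<lambda>E\<in>\<epsilon>. c_map (subtopology X (X closure_of E)) (a E))"

definition pi0_to_c :: "'a topology \<Rightarrow> 'a set set \<Rightarrow> ('a set \<Rightarrow> 'a set) \<Rightarrow> 'a set \<Rightarrow> 'a set" where
  "pi0_to_c X \<epsilon> a = (\<lambda>E\<in>\<epsilon>. c_map (subtopology X E) (a E))"

definition bar_pi0_to_bar_c :: "'a topology \<Rightarrow> 'a set set \<Rightarrow> ('a set \<Rightarrow> 'a set) \<Rightarrow> 'a set \<Rightarrow> 'a set" where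
  "bar_pi0_to_bar_c X \<epsilon> a = (\<lambda>E\<in>\<epsilon>. c_map (subtopology X (X closure_of E)) (a E))"

section \<open>Evaluation maps and their fibres\<close>

definition e0 :: "'a topology \<Rightarrow> 'a set set \<Rightarrow> 'a \<Rightarrow> 'a set \<Rightarrow> 'a set" where
  "e0 X \<epsilon> p = (\<lambda>E\<in>\<epsilon>. path_component_of_set (subtopology X E) p)"

definition e :: "'a topology \<Rightarrow> 'a set set \<Rightarrow> 'a \<Rightarrow> 'a set \<Rightarrow> 'a set" where
  "e X \<epsilon> p = (\<lambda>E\<in>\<epsilon>. connected_component_of_set (subtopology X E) p)"

definition bar_e0 :: "'a topology \<Rightarrow> 'a set set \<Rightarrow> 'a \<Rightarrow> 'a set \<Rightarrow> 'a set" where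
  "bar_e0 X \<epsilon> p = (\<lambda>E\<in>\<epsilon>. path_component_of_set (subtopology X (X closure_of E)) p)"

definition bar_e :: "'a topology \<Rightarrow> 'a set set \<Rightarrow> 'a \<Rightarrow> 'a set \<Rightarrow> 'a set" where
  "bar_e X \<epsilon> p = (\<lambda>E\<in>\<epsilon>. connected_component_of_set (subtopology X (X closure_of E)) p)"

definition L0_at :: "'a topology \<Rightarrow> 'a set set \<Rightarrow> ('a set \<Rightarrow> 'a set) \<Rightarrow> 'a set" where
  "L0_at X \<epsilon> a = {p \<in> limit_set X \<epsilon>. e0 X \<epsilon> p = a}"

definition L_at :: "'a topology \<Rightarrow> 'a set set \<Rightarrow> ('a set \<Rightarrow> 'a set) \<Rightarrow> 'a set" where
  "L_at X \<epsilon> a = {p \<in> limit_set X \<epsilon>. e X \<epsilon> p = a}"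

definition bar_L0_at :: "'a topology \<Rightarrow> 'a set set \<Rightarrow> ('a set \<Rightarrow> 'a set) \<Rightarrow> 'a set" where
  "bar_L0_at X \<epsilon> a = {p \<in> bar_limit_set X \<epsilon>. bar_e0 X \<epsilon> p = a}"

definition bar_L_at :: "'a topology \<Rightarrow> 'a set set \<Rightarrow> ('a set \<Rightarrow> 'a set) \<Rightarrow> 'a set" where
  "bar_L_at X \<epsilon> a = {p \<in> bar_limit_set X \<epsilon>. bar_e X \<epsilon> p = a}"

end

theory Submission
  imports Defs
begin

text \<open>Path-components of members of \<open>\<epsilon>\<close> are open and coincide with their connected components, and
  if \<open>E'\<close> has closure in \<open>E\<close> then every component of this closure lies in a path-component of \<open>E\<close>.
  Hence all four inverse systems are interleaved and have the same limit. The fibre over an end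
  \<open>a\<close> is \<open>\<Inter>E\<in>\<epsilon>. a E\<close>, whichever system is used. A path-component of \<open>E\<close> is also relatively
  closed in \<open>E\<close>, so this fibre is the directed intersection of the closures of the connected sets
  \<open>a E\<close>, eventually inside a compact set: it is compact and non-empty, and connected in the Hausdorff
  case. So the limit set, which is compact, maps onto the space of ends, where the discrete
  spaces \<open>\<pi>\<^sub>0(E)\<close> separate the points by clopen sets.\<close>

section \<open>Directed intersections of closed sets\<close>

text \<open>\<open>U\<close> and the complements of the \<open>C i\<close> cover \<open>K\<close>. A
  finite subcover involves finitely many \<open>C i\<close>, and directedness puts one
  \<open>C k\<close> below them all. With \<open>U = {}\<close> this is Cantor's intersection
  theorem.\<close>

lemma compactin_directed_Inter_subset:
  assumes K: "compactin X K" and U: "openin X U" and I: "I \<noteq> {}"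
    and cl: "\<And>i. i \<in> I \<Longrightarrow> closedin X (C i)"
    and dir: "\<And>i j. i \<in> I \<Longrightarrow> j \<in> I \<Longrightarrow> \<exists>k\<in>I. C k \<subseteq> C i \<inter> C j"
    and sub: "K \<inter> (\<Inter>i\<in>I. C i) \<subseteq> U"
  shows "\<exists>i\<in>I. K \<inter> C i \<subseteq> U"
proof -
  let ?\<U> = "insert U ((\<lambda>i. topspace X - C i) ` I)"
  have "K \<subseteq> \<Union>?\<U>"
    using sub compactin_subset_topspace [OF K] by auto
  moreover have "openin X V" if "V \<in> ?\<U>" for V
    using that U cl by auto
  ultimately obtain \<F> where \<F>: "finite \<F>" "\<F> \<subseteq> ?\<U>" "K \<subseteq> \<Union>\<F>"
    using K unfolding compactin_def by meson
  have "finite (\<F> - {U})" "\<F> - {U} \<subseteq> (\<lambda>i. topspace X - C i) ` I"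
    using \<F> by auto
  then obtain J where J: "J \<subseteq> I" "finite J" "\<F> - {U} = (\<lambda>i. topspace X - C i) ` J"
    by (meson finite_subset_image)
  have "\<exists>k\<in>I. C k \<subseteq> (\<Inter>i\<in>J. C i)"
    using J(2,1)
  proof (induction J)
    case empty
    then show ?case using I by auto
  next
    case (insert j J)
    then obtain k where "k \<in> I" "C k \<subseteq> (\<Inter>i\<in>J. C i)" by auto
    moreover obtain l where "l \<in> I" "C l \<subseteq> C j \<inter> C k"
      using dir [of j k] insert.prems \<open>k \<in> I\<close> by auto
    ultimately show ?case by auto
  qed
  then obtain k where k: "k \<in> I" "C k \<subseteq> (\<Inter>i\<in>J. C i)" by auto
  have "K \<subseteq> U \<union> \<Union>(\<F> - {U})"
    using \<F>(3) by auto
  then have "K \<inter> C k \<subseteq> U"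
    using k(2) unfolding J(3) by auto
  with k(1) show ?thesis by auto
qed

text \<open>Normality surrounds the two halves of a separation of the intersection by disjoint open
  sets. By compactness some \<open>C i\<close> already lies in their union, so it would be
  disconnected itself.\<close>

lemma connectedin_directed_Inter:
  assumes X: "compact_space X" "Hausdorff_space X" and I: "I \<noteq> {}"
    and cl: "\<And>i. i \<in> I \<Longrightarrow> closedin X (C i)"
    and con: "\<And>i. i \<in> I \<Longrightarrow> connectedin X (C i)"
    and dir: "\<And>i j. i \<in> I \<Longrightarrow> j \<in> I \<Longrightarrow> \<exists>k\<in>I. C k \<subseteq> C i \<inter> C j"
  shows "connectedin X (\<Inter>i\<in>I. C i)"
proof -
  let ?S = "\<Inter>i\<in>I. C i"
  have S: "closedin X ?S"
    using I cl by auto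
  have separation: False if PQ: "closedin X P" "closedin X Q" and "?S \<subseteq> P \<union> Q" "P \<inter> Q \<inter> ?S = {}"
    and ne: "P \<inter> ?S \<noteq> {}" "Q \<inter> ?S \<noteq> {}" for P Q
  proof -
    have "normal_space X"
      using X compact_Hausdorff_or_regular_imp_normal_space by blast
    moreover have "closedin X (P \<inter> ?S)" "closedin X (Q \<inter> ?S)" "disjnt (P \<inter> ?S) (Q \<inter> ?S)"
      using PQ S \<open>P \<inter> Q \<inter> ?S = {}\<close> by (auto simp: disjnt_def)
    ultimately obtain U V where UV: "openin X U" "openin X V" "P \<inter> ?S \<subseteq> U" "Q \<inter> ?S \<subseteq> V" "disjnt U V"
      unfolding normal_space_def by meson
    have "\<exists>i\<in>I. topspace X \<inter> C i \<subseteq> U \<union> V"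
    proof (rule compactin_directed_Inter_subset)
      show "compactin X (topspace X)"
        using X(1) by (simp add: compact_space_def)
      show "topspace X \<inter> ?S \<subseteq> U \<union> V"
        using UV \<open>?S \<subseteq> P \<union> Q\<close> by auto
    qed (use UV I cl dir in auto)
    then obtain i where i: "i \<in> I" "topspace X \<inter> C i \<subseteq> U \<union> V" by auto
    then have "C i \<subseteq> U \<union> V"
      using closedin_subset [OF cl] by blast
    moreover have "U \<inter> C i \<noteq> {}" "V \<inter> C i \<noteq> {}" "U \<inter> V \<inter> C i = {}"
      using ne UV i(1) by (auto simp: disjnt_def)
    ultimately show False
      using con [OF i(1)] UV(1,2) unfolding connectedin by blast
  qed
  show ?thesis
    unfolding connectedin_closedin
  proof (intro conjI notI)
    show "?S \<subseteq> topspace X" by (rule closedin_subset [OF S])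
  qed (elim exE conjE, rule separation)
qed

section \<open>Profinite spaces\<close>

lemma topspace_inverse_limit:
  "x \<in> topspace (inverse_limit I le T f) \<longleftrightarrow>
     x \<in> (\<Pi>\<^sub>E i\<in>I. topspace (T i)) \<and> (\<forall>i\<in>I. \<forall>j\<in>I. le i j \<longrightarrow> f i j (x j) = x i)"
  by (auto simp: inverse_limit_def)

text \<open>Both spaces have the same point type because \<open>profinite_space\<close> draws its
  indices and finite spaces from that type; the four end spaces share one type as well.\<close>

lemma profinite_space_homeomorphic:
  fixes S T :: "'a topology"
  assumes "profinite_space S" "T homeomorphic_space S"
  shows "profinite_space T"
proof -
  have "S homeomorphic_space L \<longleftrightarrow> T homeomorphic_space L" for L :: "('a set set \<Rightarrow> 'a set) topology"
    using assms(2) homeomorphic_space_sym homeomorphic_space_trans by metis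
  with assms(1) show ?thesis
    by (simp add: profinite_space_def)
qed

text \<open>A continuous bijection from a compact space to a Hausdorff limit is a homeomorphism. For
  the canonical map, clopen separation gives injectivity and compactness gives surjectivity.\<close>

lemma profinite_space_if_compact_separated:
  fixes T :: "'b topology"
  assumes comp: "compact_space T"
    and sep: "\<And>x y. x \<in> topspace T \<Longrightarrow> y \<in> topspace T \<Longrightarrow> x \<noteq> y \<Longrightarrow>
      \<exists>U. openin T U \<and> closedin T U \<and> x \<in> U \<and> y \<notin> U"
  shows "profinite_space T"
proof -
  \<comment> \<open>\<open>T\<close> is the limit of its finite partitions into non-empty open sets.\<close>
  define I where "I = {P. finite P \<and> {} \<notin> P \<and> \<Union>P = topspace T \<and> pairwise disjnt P \<and> (\<forall>B\<in>P. openin T B)}"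
  \<comment> \<open>\<open>le P Q\<close> says that \<open>Q\<close> refines \<open>P\<close>.
    Blocks are disjoint, so at most one contains a given point or non-empty set, and the unions in
    \<open>f\<close> and \<open>q\<close> merely pick it out.\<close>
  define le where "le = (\<lambda>P Q :: 'b set set. \<forall>C\<in>Q. \<exists>B\<in>P. C \<subseteq> B)"
  define f where "f = (\<lambda>(P :: 'b set set) (Q :: 'b set set) C. \<Union>{B\<in>P. C \<subseteq> B})"
  define q where "q = (\<lambda>x. \<lambda>P\<in>I. \<Union>{B\<in>P. x \<in> B})"
  define D where "D = (\<lambda>P :: 'b set set. discrete_topology P)"
  let ?L = "inverse_limit I le D f"
  have uniq: "B = C" if "P \<in> I" "B \<in> P" "C \<in> P" "x \<in> B" "x \<in> C" for P B C x
    using that unfolding I_def pairwise_def disjnt_def by auto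
  have ne: "B \<noteq> {}" if "P \<in> I" "B \<in> P" for P B
    using that unfolding I_def by auto
  have f_eq: "f P Q C = B" if "P \<in> I" "B \<in> P" "C \<subseteq> B" and C: "C \<noteq> {}" for P Q B C
  proof -
    obtain x where "x \<in> C" using C by auto
    then have "{B'\<in>P. C \<subseteq> B'} = {B}"
      using that uniq [of P] by blast
    then show ?thesis by (simp add: f_def)
  qed
  have q_eq: "q x P = B" if "P \<in> I" "B \<in> P" "x \<in> B" for x P B
  proof -
    have "{B'\<in>P. x \<in> B'} = {B}"
      using that uniq [of P] by blast
    then show ?thesis by (simp add: q_def that(1))
  qed
  have cover: "\<exists>B\<in>P. x \<in> B" if "P \<in> I" "x \<in> topspace T" for P x
    using that unfolding I_def by auto
  have q_in: "q x P \<in> P" "x \<in> q x P" if "P \<in> I" "x \<in> topspace T" for P x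
    using cover [OF that] q_eq [OF that(1)] by auto
  have opn: "openin T B" and cls: "closedin T B" if "P \<in> I" "B \<in> P" for P B
  proof -
    show "openin T B" using that by (auto simp: I_def)
    have "\<Union>P = topspace T"
      using that by (simp add: I_def)
    then have "topspace T - B = \<Union>(P - {B})"
      using that uniq [OF that(1)] by blast
    moreover have "openin T (\<Union>(P - {B}))"
      using that by (auto simp: I_def)
    ultimately show "closedin T B"
      using openin_subset [OF \<open>openin T B\<close>] by (simp add: closedin_def)
  qed
  have common: "\<exists>R\<in>I. le P R \<and> le Q R" if "P \<in> I" "Q \<in> I" for P Q
  proof
    \<comment> \<open>The pairwise intersections of blocks, without the empty one, form a common
      refinement.\<close>
    let ?R = "(\<lambda>(B, C). B \<inter> C) ` (P \<times> Q) - {{}}"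
    show "le P ?R \<and> le Q ?R"
      by (force simp: le_def)
    have "\<Union>?R = \<Union>P \<inter> \<Union>Q"
      by auto
    then have "\<Union>?R = topspace T"
      using that by (simp add: I_def)
    moreover have "pairwise disjnt ?R"
    proof (rule pairwiseI)
      fix S S' assume "S \<in> ?R" "S' \<in> ?R" "S \<noteq> S'"
      then obtain B C B' C' where "B \<in> P" "B' \<in> P" "C \<in> Q" "C' \<in> Q" "S = B \<inter> C" "S' = B' \<inter> C'"
        by auto
      then show "disjnt S S'"
        using uniq [OF that(1), of B B'] uniq [OF that(2), of C C'] \<open>S \<noteq> S'\<close>
        unfolding disjnt_iff by auto
    qed
    moreover have "\<forall>B\<in>?R. openin T B"
      using opn that by auto
    ultimately show "?R \<in> I"
      using that unfolding I_def by auto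
  qed
  \<comment> \<open>The one-block partition; removing \<open>{}\<close> makes it the empty partition
    when \<open>T\<close> has no points.\<close>
  have triv: "{topspace T} - {{}} \<in> I"
    unfolding I_def by (auto simp: pairwise_def)
  have le_trans: "le P R" if "le P Q" "le Q R" for P Q R
    using that unfolding le_def by (meson subset_trans)
  have f_in: "f P Q C \<in> P \<and> C \<subseteq> f P Q C" if PQ: "P \<in> I" "Q \<in> I" "le P Q" and C: "C \<in> Q" for P Q C
  proof -
    obtain B where "B \<in> P" "C \<subseteq> B" using PQ C unfolding le_def by auto
    then show ?thesis using f_eq [OF PQ(1), of B C] ne [OF PQ(2) C] by simp
  qed
  have sys: "inverse_system I le D f"
    unfolding inverse_system_def
  proof (intro conjI ballI impI)
    show "I \<noteq> {}" using triv by auto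
    show "le P P" for P by (auto simp: le_def)
    show "le P R" if "le P Q \<and> le Q R" for P Q R using that le_trans by blast
    show "\<exists>R\<in>I. le P R \<and> le Q R" if "P \<in> I" "Q \<in> I" for P Q using common that .
    show "continuous_map (D Q) (D P) (f P Q)" if "P \<in> I" "Q \<in> I" "le P Q" for P Q
      using f_in [OF that] by (auto simp: D_def)
    show "f P P C = C" if "P \<in> I" "C \<in> topspace (D P)" for P C
      using f_eq [of P C C] ne that by (simp add: D_def)
    show "f P Q (f Q R C) = f P R C"
      if "P \<in> I" "Q \<in> I" "R \<in> I" "le P Q \<and> le Q R" "C \<in> topspace (D R)" for P Q R C
    proof -
      have C: "C \<in> R" using that by (simp add: D_def)
      have *: "f Q R C \<in> Q" "C \<subseteq> f Q R C" using f_in [of Q R C] that C by auto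
      then have "f P Q (f Q R C) \<in> P" "f Q R C \<subseteq> f P Q (f Q R C)"
        using f_in [of P Q] that by auto
      then show ?thesis
        using f_eq [of P "f P Q (f Q R C)" C R] * ne [OF that(3) C] that(1) by auto
    qed
  qed
  have q_thread: "q x \<in> topspace ?L" if x: "x \<in> topspace T" for x
  proof -
    have "f P Q (q x Q) = q x P" if "P \<in> I" "Q \<in> I" "le P Q" for P Q
      using f_in [OF that, of "q x Q"] q_in [OF \<open>Q \<in> I\<close> x] q_eq [OF \<open>P \<in> I\<close>] by fastforce
    then show ?thesis
      using q_in x by (auto simp: topspace_inverse_limit D_def q_def)
  qed
  have "homeomorphic_map T ?L q"
  proof (rule continuous_imp_homeomorphic_map)
    show "compact_space T" by (fact comp)
    have "Hausdorff_space (product_topology D I)"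
      by (simp add: Hausdorff_space_product_topology D_def Hausdorff_space_discrete_topology)
    then show "Hausdorff_space ?L"
      unfolding inverse_limit_def by (rule Hausdorff_space_subtopology)
    have "continuous_map T (D P) (\<lambda>x. q x P)" if P: "P \<in> I" for P
    proof -
      have "openin T {x \<in> topspace T. q x P \<in> V}" if "V \<subseteq> P" for V
      proof -
        have "{x \<in> topspace T. q x P \<in> V} = \<Union>V"
        proof (intro set_eqI iffI)
          fix x assume "x \<in> \<Union>V"
          then obtain B where B: "B \<in> V" "x \<in> B" by auto
          then show "x \<in> {x \<in> topspace T. q x P \<in> V}"
            using q_eq [OF P, of B x] that openin_subset [OF opn [OF P]] by auto
        qed (use q_in [OF P] in auto)
        moreover have "openin T (\<Union>V)"
          using opn [OF P] that by auto
        ultimately show ?thesis by simp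
      qed
      then show ?thesis
        using q_in [OF P] by (auto simp: continuous_map_def D_def)
    qed
    then have "continuous_map T (product_topology D I) q"
      by (auto simp: continuous_map_componentwise q_def)
    then show "continuous_map T ?L q"
      unfolding inverse_limit_def continuous_map_in_subtopology
      using q_thread by (auto simp: topspace_inverse_limit)
    show "inj_on q (topspace T)"
    proof (rule inj_onI, rule ccontr)
      fix x y assume xy: "x \<in> topspace T" "y \<in> topspace T" "q x = q y" "x \<noteq> y"
      then obtain U where U: "openin T U" "closedin T U" "x \<in> U" "y \<notin> U"
        using sep by metis
      \<comment> \<open>The two-block partition cut out by \<open>U\<close> tells \<open>x\<close>
        and \<open>y\<close> apart.\<close>
      then have P: "{U, topspace T - U} - {{}} \<in> I"
        using openin_subset [of T U] unfolding I_def by (auto simp: pairwise_def disjnt_def)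
      show False
        using q_eq [OF P, of U x] q_in(2) [OF P xy(2)] U xy by auto
    qed
    show "q ` topspace T = topspace ?L"
    proof
      show "q ` topspace T \<subseteq> topspace ?L" using q_thread by auto
      show "topspace ?L \<subseteq> q ` topspace T"
      proof
        fix a assume a: "a \<in> topspace ?L"
        have aI: "a P \<in> P" if "P \<in> I" for P
          using a that by (auto simp: topspace_inverse_limit D_def)
        have af: "a Q \<subseteq> a P" if "P \<in> I" "Q \<in> I" "le P Q" for P Q
          using a f_in [OF that aI] that by (auto simp: topspace_inverse_limit)
        \<comment> \<open>A thread is a directed family of non-empty clopen blocks, so compactness
          gives a common point, and such a point is a preimage of \<open>a\<close>.\<close>
        have "(\<Inter>P\<in>I. a P) \<noteq> {}"
        proof
          assume emp: "(\<Inter>P\<in>I. a P) = {}"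
          have "\<exists>P\<in>I. topspace T \<inter> a P \<subseteq> {}"
          proof (rule compactin_directed_Inter_subset)
            show "compactin T (topspace T)"
              using comp by (simp add: compact_space_def)
            show "\<exists>R\<in>I. a R \<subseteq> a P \<inter> a Q" if "P \<in> I" "Q \<in> I" for P Q
              using common [OF that] af that by (meson Int_greatest)
          qed (use triv emp cls aI in auto)
          then show False
            using aI ne openin_subset [OF opn] by blast
        qed
        then obtain x where x: "x \<in> (\<Inter>P\<in>I. a P)" by auto
        then have "x \<in> topspace T"
          using triv aI openin_subset [OF opn] by blast
        moreover have "q x = a"
        proof
          fix P show "q x P = a P"
            using q_eq [OF _ aI, of P x] x a
            by (cases "P \<in> I") (auto simp: q_def topspace_inverse_limit PiE_def extensional_def)
        qed
        ultimately show "a \<in> q ` topspace T" by auto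
      qed
    qed
  qed
  then have "T homeomorphic_space ?L"
    by (rule homeomorphic_map_imp_homeomorphic_space)
  moreover have "\<forall>P\<in>I. finite P"
    by (auto simp: I_def)
  ultimately show ?thesis
    unfolding profinite_space_def
    by (intro exI [of _ I] exI [of _ le] exI [of _ "\<lambda>P. P"] exI [of _ f])
      (use sys in \<open>simp add: D_def\<close>)
qed

section \<open>Systems of components\<close>

text \<open>\<open>Q E y\<close> is the component of \<open>y\<close> in \<open>A E\<close>. The four end spaces arise by taking for \<open>A E\<close>
  either \<open>E\<close> or its closure, and for \<open>Q\<close> path-components or connected components.\<close>

locale component_system =
  fixes X :: "'a topology" and \<epsilon> :: "'a set set"
    and A :: "'a set \<Rightarrow> 'a set" and Q :: "'a set \<Rightarrow> 'a \<Rightarrow> 'a set"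
  assumes nonempty: "\<epsilon> \<noteq> {}"
    and directed: "\<lbrakk>E \<in> \<epsilon>; F \<in> \<epsilon>\<rbrakk> \<Longrightarrow> E \<inter> F \<in> \<epsilon>"
    and space_subset: "E \<in> \<epsilon> \<Longrightarrow> A E \<subseteq> topspace X"
    and class_subset: "E \<in> \<epsilon> \<Longrightarrow> Q E y \<subseteq> A E"
    and class_refl: "\<lbrakk>E \<in> \<epsilon>; y \<in> A E\<rbrakk> \<Longrightarrow> y \<in> Q E y"
    and class_eq: "\<lbrakk>E \<in> \<epsilon>; z \<in> Q E y\<rbrakk> \<Longrightarrow> Q E z = Q E y"
    and class_mono: "\<lbrakk>E \<in> \<epsilon>; F \<in> \<epsilon>; F \<subseteq> E\<rbrakk> \<Longrightarrow> Q F y \<subseteq> Q E y"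
begin

text \<open>The bonding maps are \<open>pi0_map\<close> and \<open>c_map\<close> written out, so
  that the four end spaces become instances by mere unfolding.\<close>

definition ends :: "('a set \<Rightarrow> 'a set) topology" where
  "ends = inverse_limit \<epsilon> (\<lambda>E F. F \<subseteq> E)
     (\<lambda>E. quotient_topology (subtopology X (A E)) (Q E)) (\<lambda>E F C. \<Union>y\<in>C. Q E y)"

definition eval :: "'a \<Rightarrow> 'a set \<Rightarrow> 'a set" where
  "eval p = (\<lambda>E\<in>\<epsilon>. Q E p)"

definition fibre :: "('a set \<Rightarrow> 'a set) \<Rightarrow> 'a set" where
  "fibre a = {p \<in> (\<Inter>E\<in>\<epsilon>. A E). eval p = a}"

lemma class_unique:
  assumes "E \<in> \<epsilon>" "C \<in> Q E ` A E" "y \<in> C"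
  shows "Q E y = C"
  using assms(2,3) class_eq [OF assms(1)] by blast

lemma class_nonempty: "\<lbrakk>E \<in> \<epsilon>; C \<in> Q E ` A E\<rbrakk> \<Longrightarrow> C \<noteq> {}"
  using class_refl by auto

text \<open>All points of a class have that same class, so the union takes a single value. This
  computes the bonding maps and, later, \<open>lim_map\<close>.\<close>

lemma Union_classes:
  assumes "E \<in> \<epsilon>" "C \<in> Q E ` A E" "D \<subseteq> C" "D \<noteq> {}"
  shows "(\<Union>y\<in>D. Q E y) = C"
proof -
  have "Q E y = C" if "y \<in> D" for y
    using class_unique [OF assms(1,2)] assms(3) that by blast
  with assms(4) show ?thesis by auto
qed

lemma Union_classes_of_subset:
  assumes E: "E \<in> \<epsilon>" "D \<subseteq> A E"
  shows "D \<subseteq> (\<Union>y\<in>D. Q E y)"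
  using class_refl [OF E(1)] E(2) by blast

lemma topspace_quotient: "E \<in> \<epsilon> \<Longrightarrow> topspace (quotient_topology (subtopology X (A E)) (Q E)) = Q E ` A E"
  using space_subset by (simp add: inf.absorb2)

lemma space_mono: "\<lbrakk>E \<in> \<epsilon>; F \<in> \<epsilon>; F \<subseteq> E\<rbrakk> \<Longrightarrow> A F \<subseteq> A E"
  by (meson class_mono class_refl class_subset subset_iff)

text \<open>Trades the bonding equations for inclusions: \<open>a F\<close> lies in the union of the
  classes of its points, and this union is \<open>a E\<close> as soon as
  \<open>a F \<subseteq> a E\<close>.\<close>

lemma topspace_ends:
  "a \<in> topspace ends \<longleftrightarrow> a \<in> extensional \<epsilon> \<and> (\<forall>E\<in>\<epsilon>. a E \<in> Q E ` A E) \<and>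
     (\<forall>E\<in>\<epsilon>. \<forall>F\<in>\<epsilon>. F \<subseteq> E \<longrightarrow> a F \<subseteq> a E)"
proof -
  have *: "(\<Union>y\<in>a F. Q E y) = a E \<longleftrightarrow> a F \<subseteq> a E"
    if a: "\<forall>E\<in>\<epsilon>. a E \<in> Q E ` A E" and EF: "E \<in> \<epsilon>" "F \<in> \<epsilon>" "F \<subseteq> E" for E F
  proof
    have "a F \<subseteq> A E"
      using bspec [OF a EF(2)] class_subset [OF EF(2)] space_mono [OF EF] by auto
    then show "(\<Union>y\<in>a F. Q E y) = a E \<Longrightarrow> a F \<subseteq> a E"
      using Union_classes_of_subset [OF EF(1), of "a F"] by simp
    show "a F \<subseteq> a E \<Longrightarrow> (\<Union>y\<in>a F. Q E y) = a E"
      using Union_classes class_nonempty a EF by simp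
  qed
  have "(\<forall>E\<in>\<epsilon>. \<forall>F\<in>\<epsilon>. F \<subseteq> E \<longrightarrow> (\<Union>y\<in>a F. Q E y) = a E) \<longleftrightarrow>
      (\<forall>E\<in>\<epsilon>. \<forall>F\<in>\<epsilon>. F \<subseteq> E \<longrightarrow> a F \<subseteq> a E)" if "\<forall>E\<in>\<epsilon>. a E \<in> Q E ` A E"
    using * [OF that] by (simp cong: ball_cong imp_cong)
  moreover have "a \<in> topspace ends \<longleftrightarrow> a \<in> extensional \<epsilon> \<and> (\<forall>E\<in>\<epsilon>. a E \<in> Q E ` A E) \<and>
      (\<forall>E\<in>\<epsilon>. \<forall>F\<in>\<epsilon>. F \<subseteq> E \<longrightarrow> (\<Union>y\<in>a F. Q E y) = a E)"
  proof -
    have "(\<forall>E\<in>\<epsilon>. a E \<in> topspace (quotient_topology (subtopology X (A E)) (Q E))) \<longleftrightarrow>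
        (\<forall>E\<in>\<epsilon>. a E \<in> Q E ` A E)"
      using topspace_quotient by simp
    then show ?thesis
      unfolding ends_def topspace_inverse_limit PiE_iff by blast
  qed
  \<comment> \<open>If some \<open>a E\<close> is not a class, both sides are false.\<close>
  ultimately show ?thesis
    by (cases "\<forall>E\<in>\<epsilon>. a E \<in> Q E ` A E") simp_all
qed

lemma end_class: "\<lbrakk>a \<in> topspace ends; E \<in> \<epsilon>\<rbrakk> \<Longrightarrow> a E \<in> Q E ` A E"
  by (simp add: topspace_ends)

lemma end_mono: "\<lbrakk>a \<in> topspace ends; E \<in> \<epsilon>; F \<in> \<epsilon>; F \<subseteq> E\<rbrakk> \<Longrightarrow> a F \<subseteq> a E"
  by (simp add: topspace_ends)

text \<open>A class contains \<open>p\<close> exactly when it is the class of \<open>p\<close>. Both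
  \<open>eval p\<close> and \<open>a\<close> are extensional, so it suffices to compare them on
  \<open>\<epsilon>\<close>.\<close>

lemma fibre_eq_Inter:
  assumes "a \<in> topspace ends"
  shows "fibre a = (\<Inter>E\<in>\<epsilon>. a E)"
proof -
  have *: "p \<in> a E \<longleftrightarrow> p \<in> A E \<and> Q E p = a E" if "E \<in> \<epsilon>" for E p
  proof
    have C: "a E \<in> Q E ` A E"
      using end_class [OF assms that] .
    assume "p \<in> a E"
    then show "p \<in> A E \<and> Q E p = a E"
      using class_unique [OF that C] class_subset [OF that, of p] by auto
  next
    assume "p \<in> A E \<and> Q E p = a E"
    then show "p \<in> a E"
      using class_refl [OF that, of p] by simp
  qed
  have "eval p = a \<longleftrightarrow> (\<forall>E\<in>\<epsilon>. Q E p = a E)" for p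
    using assms by (auto simp: eval_def topspace_ends fun_eq_iff extensional_def)
  with * show ?thesis
    by (auto simp: fibre_def)
qed

lemma eval_in_ends: "p \<in> (\<Inter>E\<in>\<epsilon>. A E) \<Longrightarrow> eval p \<in> topspace ends"
  using class_mono by (auto simp: topspace_ends eval_def)

lemma eval_image:
  assumes "\<And>a. a \<in> topspace ends \<Longrightarrow> fibre a \<noteq> {}"
  shows "eval ` (\<Inter>E\<in>\<epsilon>. A E) = topspace ends"
proof (intro subset_antisym subsetI)
  fix a assume "a \<in> topspace ends"
  then obtain p where "p \<in> fibre a"
    using assms by blast
  then show "a \<in> eval ` (\<Inter>E\<in>\<epsilon>. A E)"
    unfolding fibre_def by blast
qed (use eval_in_ends in blast)

lemma continuous_map_class:
  "continuous_map (subtopology X (A E)) (quotient_topology (subtopology X (A E)) (Q E)) (Q E)"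
  by (simp add: quotient_imp_continuous_map quotient_map_quotient_topology)

lemma continuous_map_into_ends:
  assumes "\<And>E. E \<in> \<epsilon> \<Longrightarrow>
      continuous_map Y (quotient_topology (subtopology X (A E)) (Q E)) (\<lambda>y. g y E)"
    and "\<And>y. y \<in> topspace Y \<Longrightarrow> g y \<in> topspace ends"
  shows "continuous_map Y ends g"
  using assms(2) assms(1)
  unfolding ends_def inverse_limit_def continuous_map_in_subtopology continuous_map_componentwise
  by (auto simp: PiE_def)

lemma continuous_map_ends_component:
  assumes "E \<in> \<epsilon>"
  shows "continuous_map ends (quotient_topology (subtopology X (A E)) (Q E)) (\<lambda>a. a E)"
  unfolding ends_def inverse_limit_def
  by (intro continuous_map_from_subtopology continuous_map_product_projection assms)

lemma continuous_map_eval: "continuous_map (subtopology X (\<Inter>E\<in>\<epsilon>. A E)) ends eval"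
proof (rule continuous_map_into_ends)
  fix E assume E: "E \<in> \<epsilon>"
  then have "continuous_map (subtopology X (\<Inter>E\<in>\<epsilon>. A E))
      (quotient_topology (subtopology X (A E)) (Q E)) (Q E)"
    by (intro continuous_map_from_subtopology_mono [OF continuous_map_class]) auto
  with E show "continuous_map (subtopology X (\<Inter>E\<in>\<epsilon>. A E))
      (quotient_topology (subtopology X (A E)) (Q E)) (\<lambda>p. eval p E)"
    by (simp add: eval_def)
qed (use eval_in_ends in auto)

end

section \<open>Maps of end spaces induced by reindexed inclusions of classes\<close>

text \<open>The target class at \<open>E\<close> receives the source class at the index
  \<open>\<phi> E\<close>. With the identity as \<open>\<phi>\<close> this yields the canonical
  maps; shrinking the index makes room for inverses.\<close>

locale component_morphism =
  src: component_system X \<epsilon> A P + tgt: component_system X \<epsilon> B Q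
  for X :: "'a topology" and \<epsilon> A P B Q +
  fixes \<phi> :: "'a set \<Rightarrow> 'a set"
  assumes index: "E \<in> \<epsilon> \<Longrightarrow> \<phi> E \<in> \<epsilon>"
    and index_subset: "E \<in> \<epsilon> \<Longrightarrow> \<phi> E \<subseteq> E"
    and class_into: "E \<in> \<epsilon> \<Longrightarrow> P (\<phi> E) y \<subseteq> Q E y"
begin

text \<open>When \<open>\<phi>\<close> is the identity this unfolds to the canonical maps. The
  restriction keeps values extensional, as points of a product are.\<close>

definition lim_map :: "('a set \<Rightarrow> 'a set) \<Rightarrow> 'a set \<Rightarrow> 'a set" where
  "lim_map a = (\<lambda>E\<in>\<epsilon>. \<Union>y\<in>a (\<phi> E). Q E y)"

lemma space_into: "E \<in> \<epsilon> \<Longrightarrow> A (\<phi> E) \<subseteq> B E"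
  by (meson class_into index src.class_refl subset_iff tgt.class_subset)

lemma Union_class_into:
  assumes E: "E \<in> \<epsilon>" and x: "x \<in> A (\<phi> E)"
  shows "(\<Union>y\<in>P (\<phi> E) x. Q E y) = Q E x"
  using src.class_refl [OF index [OF E] x] class_into [OF E] space_into [OF E] x
  by (intro tgt.Union_classes [OF E]) auto

text \<open>A source class \<open>a (\<phi> E)\<close> sits inside a single target class, and the
  union returns exactly that class.\<close>

lemma lim_map_class:
  assumes a: "a \<in> topspace src.ends" and E: "E \<in> \<epsilon>"
  shows "lim_map a E \<in> Q E ` B E" and "a (\<phi> E) \<subseteq> lim_map a E"
proof -
  obtain x where x: "x \<in> A (\<phi> E)" "a (\<phi> E) = P (\<phi> E) x"
    using a index [OF E] by (auto simp: src.topspace_ends)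
  then have "lim_map a E = Q E x"
    using Union_class_into [OF E] E by (simp add: lim_map_def)
  then show "lim_map a E \<in> Q E ` B E" "a (\<phi> E) \<subseteq> lim_map a E"
    using x space_into [OF E] class_into [OF E] by auto
qed

lemma lim_map_in_ends:
  assumes a: "a \<in> topspace src.ends"
  shows "lim_map a \<in> topspace tgt.ends"
  unfolding tgt.topspace_ends
proof (intro conjI ballI impI)
  fix E F assume EF: "E \<in> \<epsilon>" "F \<in> \<epsilon>" "F \<subseteq> E"
  \<comment> \<open>A point \<open>z\<close> of \<open>a ?G\<close> lies in both values, which are
    therefore the classes of \<open>z\<close> at \<open>E\<close> and at \<open>F\<close>; these are
    comparable.\<close>
  let ?G = "\<phi> E \<inter> \<phi> F"
  have G: "?G \<in> \<epsilon>"
    using src.directed index EF by simp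
  obtain z where "z \<in> a ?G"
    using src.class_nonempty [OF G src.end_class [OF a G]] by blast
  then have "z \<in> a (\<phi> E)" "z \<in> a (\<phi> F)"
    using src.end_mono [OF a index G] EF by blast+
  then have "z \<in> lim_map a E" "z \<in> lim_map a F"
    using lim_map_class(2) [OF a] EF by auto
  then have "lim_map a E = Q E z" "lim_map a F = Q F z"
    using tgt.class_unique [OF _ lim_map_class(1) [OF a]] EF by simp_all
  then show "lim_map a F \<subseteq> lim_map a E"
    using tgt.class_mono EF by simp
qed (use lim_map_class [OF a] in \<open>auto simp: lim_map_def\<close>)

text \<open>Classes that meet are equal, so one common point for each \<open>E\<close> identifies
  the image end.\<close>

lemma lim_map_unique:
  assumes a: "a \<in> topspace src.ends" and b: "b \<in> topspace tgt.ends"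
    and meet: "\<And>E. E \<in> \<epsilon> \<Longrightarrow> a (\<phi> E) \<inter> b E \<noteq> {}"
  shows "lim_map a = b"
proof
  fix E
  show "lim_map a E = b E"
  proof (cases "E \<in> \<epsilon>")
    case True
    then obtain z where "z \<in> a (\<phi> E)" "z \<in> b E"
      using meet by blast
    then show ?thesis
      using tgt.class_unique [OF True] lim_map_class [OF a True] b True
      by (metis subsetD tgt.topspace_ends)
  next
    case False
    then show ?thesis
      using b by (simp add: lim_map_def tgt.topspace_ends extensional_def)
  qed
qed

text \<open>Each coordinate is the projection to \<open>\<phi> E\<close> followed by the map that
  \<open>Q E\<close>, restricted to \<open>A (\<phi> E)\<close>, induces on the quotient.\<close>

lemma continuous_map_lim_map: "continuous_map src.ends tgt.ends lim_map"
proof (rule tgt.continuous_map_into_ends)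
  fix E assume E: "E \<in> \<epsilon>"
  let ?Y = "subtopology X (A (\<phi> E))" and ?Z = "quotient_topology (subtopology X (B E)) (Q E)"
  have "continuous_map ?Y ?Z (Q E)"
    using continuous_map_from_subtopology_mono [OF tgt.continuous_map_class space_into [OF E]] .
  then have "continuous_map ?Y ?Z ((\<lambda>C. \<Union>y\<in>C. Q E y) \<circ> P (\<phi> E))"
    by (rule continuous_map_eq) (use Union_class_into [OF E] in auto)
  then have "continuous_map (quotient_topology ?Y (P (\<phi> E))) ?Z (\<lambda>C. \<Union>y\<in>C. Q E y)"
    using continuous_compose_quotient_map quotient_map_quotient_topology by blast
  then have "continuous_map src.ends ?Z ((\<lambda>C. \<Union>y\<in>C. Q E y) \<circ> (\<lambda>a. a (\<phi> E)))"
    using continuous_map_compose src.continuous_map_ends_component index [OF E] by blast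
  then show "continuous_map src.ends ?Z (\<lambda>a. lim_map a E)"
    using E by (simp add: lim_map_def o_def)
qed (fact lim_map_in_ends)

text \<open>Each factor of the target intersection contains \<open>a (\<phi> E)\<close>, itself a
  factor of the source intersection.\<close>

lemma fibre_subset:
  assumes a: "a \<in> topspace src.ends"
  shows "src.fibre a \<subseteq> tgt.fibre (lim_map a)"
  using lim_map_class(2) [OF a] index
  unfolding src.fibre_eq_Inter [OF a] tgt.fibre_eq_Inter [OF lim_map_in_ends [OF a]] by blast

end

text \<open>Interleaved systems: morphisms in opposite directions induce mutually inverse maps,
  since a round trip only shrinks the index within one system.\<close>

locale component_isomorphism =
  fwd: component_morphism X \<epsilon> A P B Q \<phi> + bwd: component_morphism X \<epsilon> B Q A P \<psi>
  for X :: "'a topology" and \<epsilon> A P B Q \<phi> \<psi>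
begin

text \<open>\<open>a (\<phi> (\<psi> E))\<close> is a non-empty part both of \<open>a E\<close> and
  of the forward image at \<open>\<psi> E\<close>.\<close>

lemma bwd_fwd:
  assumes a: "a \<in> topspace fwd.src.ends"
  shows "bwd.lim_map (fwd.lim_map a) = a"
proof (rule bwd.lim_map_unique [OF fwd.lim_map_in_ends [OF a] a])
  fix E assume E: "E \<in> \<epsilon>"
  then have i: "\<psi> E \<in> \<epsilon>" "\<phi> (\<psi> E) \<in> \<epsilon>" "\<phi> (\<psi> E) \<subseteq> E"
    using bwd.index fwd.index bwd.index_subset fwd.index_subset by blast+
  have "a (\<phi> (\<psi> E)) \<subseteq> fwd.lim_map a (\<psi> E)"
    using fwd.lim_map_class(2) [OF a i(1)] .
  moreover have "a (\<phi> (\<psi> E)) \<subseteq> a E" "a (\<phi> (\<psi> E)) \<noteq> {}"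
    using a i E fwd.src.class_nonempty unfolding fwd.src.topspace_ends by auto
  ultimately show "fwd.lim_map a (\<psi> E) \<inter> a E \<noteq> {}"
    by auto
qed

text \<open>Exchanging the roles turns \<open>bwd_fwd\<close> into the identity for the other
  composite.\<close>

interpretation converse: component_isomorphism X \<epsilon> B Q A P \<psi> \<phi> ..

lemma homeomorphic_map_lim_map: "homeomorphic_map fwd.src.ends fwd.tgt.ends fwd.lim_map"
proof -
  have "homeomorphic_maps fwd.src.ends fwd.tgt.ends fwd.lim_map bwd.lim_map"
    unfolding homeomorphic_maps_def
    using fwd.continuous_map_lim_map bwd.continuous_map_lim_map bwd_fwd converse.bwd_fwd by blast
  then show ?thesis
    by (rule homeomorphic_maps_imp_map)
qed

lemma fibre_lim_map:
  assumes a: "a \<in> topspace fwd.src.ends"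
  shows "fwd.tgt.fibre (fwd.lim_map a) = fwd.src.fibre a"
  using fwd.fibre_subset [OF a] bwd.fibre_subset [OF fwd.lim_map_in_ends [OF a]] bwd_fwd [OF a]
  by auto

end

section \<open>Exterior spaces\<close>

text \<open>\<open>A\<close> stays abstract in order to serve both the members of
  \<open>\<epsilon>\<close> and their closures.\<close>

lemma component_system_path_component_of:
  assumes "externology X \<epsilon>" and "\<And>E. E \<in> \<epsilon> \<Longrightarrow> A E \<subseteq> topspace X"
    and mono: "\<And>E F. F \<subseteq> E \<Longrightarrow> A F \<subseteq> A E"
  shows "component_system X \<epsilon> A (\<lambda>E. path_component_of_set (subtopology X (A E)))"
proof
  show "\<epsilon> \<noteq> {}" and "\<And>E F. E \<in> \<epsilon> \<Longrightarrow> F \<in> \<epsilon> \<Longrightarrow> E \<inter> F \<in> \<epsilon>"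
    using assms(1) unfolding externology_def by blast+
  show "y \<in> path_component_of_set (subtopology X (A E)) y" if "E \<in> \<epsilon>" "y \<in> A E" for E y
    using assms(2) that by (auto simp: path_component_of_refl)
  show "path_component_of_set (subtopology X (A E)) y \<subseteq> A E" for E y
    using path_component_of_subset_topspace [of "subtopology X (A E)" y] by auto
  show "path_component_of_set (subtopology X (A E)) z = path_component_of_set (subtopology X (A E)) y"
    if "z \<in> path_component_of_set (subtopology X (A E)) y" for E y z
    by (metis mem_Collect_eq path_component_of_equiv that)
  show "path_component_of_set (subtopology X (A F)) y \<subseteq> path_component_of_set (subtopology X (A E)) y"
    if "F \<subseteq> E" for E F y
    using path_component_of_mono [OF _ mono [OF that]] by (simp add: Collect_mono)
qed (use assms(2) in blast)

lemma component_system_connected_component_of: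
  assumes "externology X \<epsilon>" and "\<And>E. E \<in> \<epsilon> \<Longrightarrow> A E \<subseteq> topspace X"
    and mono: "\<And>E F. F \<subseteq> E \<Longrightarrow> A F \<subseteq> A E"
  shows "component_system X \<epsilon> A (\<lambda>E. connected_component_of_set (subtopology X (A E)))"
proof
  show "\<epsilon> \<noteq> {}" and "\<And>E F. E \<in> \<epsilon> \<Longrightarrow> F \<in> \<epsilon> \<Longrightarrow> E \<inter> F \<in> \<epsilon>"
    using assms(1) unfolding externology_def by blast+
  show "y \<in> connected_component_of_set (subtopology X (A E)) y" if "E \<in> \<epsilon>" "y \<in> A E" for E y
    using assms(2) that by (auto simp: connected_component_of_refl)
  show "connected_component_of_set (subtopology X (A E)) y \<subseteq> A E" for E y
    using connected_component_of_subset_topspace [of "subtopology X (A E)" y] by auto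
  show "connected_component_of_set (subtopology X (A E)) z = connected_component_of_set (subtopology X (A E)) y"
    if "z \<in> connected_component_of_set (subtopology X (A E)) y" for E y z
    by (metis mem_Collect_eq connected_component_of_equiv that)
  show "connected_component_of_set (subtopology X (A F)) y \<subseteq> connected_component_of_set (subtopology X (A E)) y"
    if "F \<subseteq> E" for E F y
    using connected_component_of_mono [OF _ mono [OF that]] by (simp add: Collect_mono)
qed (use assms(2) in blast)

section \<open>Interleaving of the four systems of components\<close>

locale locally_compact_exterior_space =
  fixes X :: "'a topology" and \<epsilon> :: "'a set set"
  assumes ext: "externology X \<epsilon>"
    and lpc: "locally_path_connected_space X"
    and lci: "locally_compact_at_infinity X \<epsilon>"
begin

lemma open_ext: "E \<in> \<epsilon> \<Longrightarrow> openin X E"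
  using ext unfolding externology_def by blast

lemma ext_subset: "E \<in> \<epsilon> \<Longrightarrow> E \<subseteq> topspace X"
  using open_ext openin_subset by blast

text \<open>Witnesses of local compactness at infinity, chosen as a function so that it can reindex
  the inverse maps.\<close>

definition core :: "'a set \<Rightarrow> 'a set" where
  "core E = (SOME E'. E' \<in> \<epsilon> \<and> compactin X (X closure_of E') \<and> X closure_of E' \<subseteq> E)"

lemma core:
  assumes "E \<in> \<epsilon>"
  shows core_in: "core E \<in> \<epsilon>" and compactin_core: "compactin X (X closure_of core E)"
    and closure_core: "X closure_of core E \<subseteq> E"
proof -
  have "\<exists>E'. E' \<in> \<epsilon> \<and> compactin X (X closure_of E') \<and> X closure_of E' \<subseteq> E"
    using lci assms unfolding locally_compact_at_infinity_def by blast
  then have "core E \<in> \<epsilon> \<and> compactin X (X closure_of core E) \<and> X closure_of core E \<subseteq> E"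
    unfolding core_def by (rule someI_ex)
  then show "core E \<in> \<epsilon>" "compactin X (X closure_of core E)" "X closure_of core E \<subseteq> E"
    by auto
qed

lemma subset_closure: "E \<in> \<epsilon> \<Longrightarrow> E \<subseteq> X closure_of E"
  by (simp add: closure_of_subset ext_subset)

lemma core_subset: "E \<in> \<epsilon> \<Longrightarrow> core E \<subseteq> E"
  using closure_core subset_closure [OF core_in] by blast

sublocale pi0: component_system X \<epsilon> "\<lambda>E. E" "\<lambda>E. path_component_of_set (subtopology X E)"
  by (rule component_system_path_component_of [OF ext ext_subset])

sublocale c: component_system X \<epsilon> "\<lambda>E. E" "\<lambda>E. connected_component_of_set (subtopology X E)"
  by (rule component_system_connected_component_of [OF ext ext_subset])

sublocale bar_pi0: component_system X \<epsilon> "\<lambda>E. X closure_of E"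
    "\<lambda>E. path_component_of_set (subtopology X (X closure_of E))"
  by (rule component_system_path_component_of [OF ext closure_of_subset_topspace closure_of_mono])

sublocale bar_c: component_system X \<epsilon> "\<lambda>E. X closure_of E"
    "\<lambda>E. connected_component_of_set (subtopology X (X closure_of E))"
  by (rule component_system_connected_component_of [OF ext closure_of_subset_topspace closure_of_mono])

text \<open>Open subspaces inherit local path-connectedness, under which the two notions of
  component agree.\<close>

lemma path_eq_connected_component:
  "E \<in> \<epsilon> \<Longrightarrow>
    connected_component_of_set (subtopology X E) y = path_component_of_set (subtopology X E) y"
  using path_component_eq_connected_component_of locally_path_connected_space_open_subset
    lpc open_ext by metis

text \<open>The way back from closures: a component of the closure of \<open>core E\<close> is a
  connected subset of \<open>E\<close>, where components are path-components.\<close>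

lemma connected_component_core_subset:
  assumes "E \<in> \<epsilon>"
  shows "connected_component_of_set (subtopology X (X closure_of core E)) y
    \<subseteq> path_component_of_set (subtopology X E) y"
  using connected_component_of_mono [OF _ closure_core [OF assms]]
  by (auto simp flip: path_eq_connected_component [OF assms])

lemma path_component_closure:
  "E \<in> \<epsilon> \<Longrightarrow> path_component_of_set (subtopology X E) y
    \<subseteq> path_component_of_set (subtopology X (X closure_of E)) y"
  using path_component_of_mono [OF _ subset_closure] by (simp add: Collect_mono)

lemma connected_component_closure:
  "E \<in> \<epsilon> \<Longrightarrow> connected_component_of_set (subtopology X E) y
    \<subseteq> connected_component_of_set (subtopology X (X closure_of E)) y"
  using connected_component_of_mono [OF _ subset_closure] by (simp add: Collect_mono)

lemma path_component_subset: "path_component_of_set Y y \<subseteq> connected_component_of_set Y y"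
  by (simp add: path_component_subset_connected_component_of)

lemmas component_inclusions = path_component_closure connected_component_closure
  path_component_subset connected_component_core_subset

text \<open>Backwards, a path-component of the closure of \<open>core E\<close> is connected, so it
  falls into one path-component of \<open>E\<close>.\<close>

sublocale pi0_bar: component_isomorphism X \<epsilon>
    "\<lambda>E. E" "\<lambda>E. path_component_of_set (subtopology X E)"
    "\<lambda>E. X closure_of E" "\<lambda>E. path_component_of_set (subtopology X (X closure_of E))"
    "\<lambda>E. E" core
  by unfold_locales
    (simp_all only: core_in core_subset order_refl component_inclusions
      order_trans [OF path_component_subset connected_component_core_subset])

sublocale c_bar: component_isomorphism X \<epsilon>
    "\<lambda>E. E" "\<lambda>E. connected_component_of_set (subtopology X E)"
    "\<lambda>E. X closure_of E" "\<lambda>E. connected_component_of_set (subtopology X (X closure_of E))"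
    "\<lambda>E. E" core
  by unfold_locales
    (simp_all only: core_in core_subset order_refl component_inclusions
      order_trans [OF connected_component_core_subset path_component_subset])

text \<open>The two systems already coincide at each index, so no shift occurs in either
  direction.\<close>

sublocale pi0_c: component_isomorphism X \<epsilon>
    "\<lambda>E. E" "\<lambda>E. path_component_of_set (subtopology X E)"
    "\<lambda>E. E" "\<lambda>E. connected_component_of_set (subtopology X E)"
    "\<lambda>E. E" "\<lambda>E. E"
  by unfold_locales (simp_all only: path_eq_connected_component order_refl)

text \<open>Closures need not be locally path-connected. The inverse therefore passes through
  \<open>E\<close>: a component of the closure of \<open>core E\<close> lies in a path-component of
  \<open>E\<close>, which lies in one of the closure of \<open>E\<close>.\<close>

sublocale bar_pi0_c: component_isomorphism X \<epsilon>
    "\<lambda>E. X closure_of E" "\<lambda>E. path_component_of_set (subtopology X (X closure_of E))"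
    "\<lambda>E. X closure_of E" "\<lambda>E. connected_component_of_set (subtopology X (X closure_of E))"
    "\<lambda>E. E" core
  by unfold_locales
    (simp_all only: core_in core_subset order_refl component_inclusions
      order_trans [OF connected_component_core_subset path_component_closure])

section \<open>The limit set and the fibres over ends\<close>

lemma limit_set_eq: "limit_set X \<epsilon> = bar_limit_set X \<epsilon>"
proof
  show "limit_set X \<epsilon> \<subseteq> bar_limit_set X \<epsilon>"
    using subset_closure unfolding limit_set_def bar_limit_set_def by blast
  show "bar_limit_set X \<epsilon> \<subseteq> limit_set X \<epsilon>"
    using core_in closure_core unfolding limit_set_def bar_limit_set_def by blast
qed

lemma obtain_compact_closure:
  obtains E where "E \<in> \<epsilon>" "compactin X (X closure_of E)"
  using pi0.nonempty core_in compactin_core by blast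

text \<open>The description by closures shows that the set is closed, and it lies in a compact
  closure.\<close>

lemma compactin_limit_set: "compactin X (limit_set X \<epsilon>)"
proof -
  obtain E where E: "E \<in> \<epsilon>" "compactin X (X closure_of E)"
    by (rule obtain_compact_closure)
  have "closedin X (bar_limit_set X \<epsilon>)"
    unfolding bar_limit_set_def using pi0.nonempty by (intro closedin_INT) auto
  moreover have "bar_limit_set X \<epsilon> \<subseteq> X closure_of E"
    using E(1) by (auto simp: bar_limit_set_def)
  ultimately show ?thesis
    using E(2) closed_compactin unfolding limit_set_eq by blast
qed

lemma end_subset: "\<lbrakk>a \<in> topspace pi0.ends; E \<in> \<epsilon>\<rbrakk> \<Longrightarrow> a E \<subseteq> E"
  using pi0.end_class pi0.class_subset by fastforce

lemma openin_path_component: "E \<in> \<epsilon> \<Longrightarrow> openin X (path_component_of_set (subtopology X E) y)"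
  using openin_path_component_of_locally_path_connected_space lpc open_ext
    locally_path_connected_space_open_subset openin_trans_full by metis

text \<open>A path-component of \<open>E\<close> is open, hence relatively closed in \<open>E\<close>; so the closure of
  \<open>a (core E)\<close>, being contained in \<open>E\<close>, cannot leave \<open>a E\<close>.\<close>

lemma closure_end_core:
  assumes a: "a \<in> topspace pi0.ends" and E: "E \<in> \<epsilon>"
  shows "X closure_of a (core E) \<subseteq> a E"
proof
  fix z assume z: "z \<in> X closure_of a (core E)"
  then have zE: "z \<in> E"
    using closure_of_mono [OF end_subset [OF a core_in [OF E]]] closure_core [OF E] by blast
  let ?Q = "path_component_of_set (subtopology X E)"
  have "z \<in> ?Q z"
    by (rule pi0.class_refl [OF E zE])
  then obtain w where w: "w \<in> ?Q z" "w \<in> a (core E)"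
    using z openin_path_component [OF E, of z] unfolding in_closure_of by blast
  then have "w \<in> a E"
    using pi0.end_mono [OF a E core_in core_subset] E by blast
  then have "?Q w = a E"
    by (rule pi0.class_unique [OF E pi0.end_class [OF a E]])
  with pi0.class_eq [OF E w(1)] \<open>z \<in> ?Q z\<close> show "z \<in> a E"
    by simp
qed

text \<open>The sandwich \<open>X closure_of a (core E) \<subseteq> a E \<subseteq> X closure_of a
  E\<close> equates the two intersections. The closed sets are the ones to which compactness
  applies.\<close>

lemma fibre_eq_Inter_closure:
  assumes a: "a \<in> topspace pi0.ends"
  shows "pi0.fibre a = (\<Inter>E\<in>\<epsilon>. X closure_of a E)"
proof -
  have "a E \<subseteq> X closure_of a E" if "E \<in> \<epsilon>" for E
    using end_subset [OF a that] ext_subset [OF that] by (intro closure_of_subset) auto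
  then show ?thesis
    unfolding pi0.fibre_eq_Inter [OF a] using closure_end_core [OF a] core_in by blast
qed

lemma closure_end_directed:
  assumes a: "a \<in> topspace pi0.ends" and EF: "E \<in> \<epsilon>" "F \<in> \<epsilon>"
  shows "X closure_of a (E \<inter> F) \<subseteq> X closure_of a E \<inter> X closure_of a F"
  using pi0.end_mono [OF a _ pi0.directed [OF EF]] EF by (simp add: closure_of_mono)

text \<open>If the fibre were empty, compactness of one closure would force some
  \<open>X closure_of a E\<close> to miss it, although members of the end always meet.\<close>

lemma fibre_nonempty:
  assumes a: "a \<in> topspace pi0.ends"
  shows "pi0.fibre a \<noteq> {}"
proof
  assume emp: "pi0.fibre a = {}"
  obtain E0 where E0: "E0 \<in> \<epsilon>" "compactin X (X closure_of E0)"
    by (rule obtain_compact_closure)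
  have "\<exists>E\<in>\<epsilon>. X closure_of E0 \<inter> X closure_of a E \<subseteq> {}"
  proof (rule compactin_directed_Inter_subset [OF E0(2)])
    show "\<exists>G\<in>\<epsilon>. X closure_of a G \<subseteq> X closure_of a E \<inter> X closure_of a F"
      if "E \<in> \<epsilon>" "F \<in> \<epsilon>" for E F
      using closure_end_directed [OF a that] pi0.directed [OF that] by blast
  qed (use pi0.nonempty emp in \<open>simp_all add: fibre_eq_Inter_closure [OF a]\<close>)
  then obtain E where E: "E \<in> \<epsilon>" "X closure_of E0 \<inter> X closure_of a E = {}"
    by blast
  \<comment> \<open>The non-empty class \<open>a (E0 \<inter> E)\<close> lies in both of the
    supposedly disjoint closures.\<close>
  have G: "E0 \<inter> E \<in> \<epsilon>"
    using pi0.directed E0 E by blast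
  have "a (E0 \<inter> E) \<subseteq> a E0" "a (E0 \<inter> E) \<subseteq> a E"
    using pi0.end_mono [OF a _ G] E0 E by auto
  moreover have "a E0 \<subseteq> X closure_of E0"
    using end_subset [OF a E0(1)] subset_closure [OF E0(1)] by blast
  moreover have "a E \<subseteq> X closure_of a E"
    using end_subset [OF a E(1)] ext_subset [OF E(1)] by (intro closure_of_subset) auto
  ultimately show False
    using pi0.class_nonempty [OF G pi0.end_class [OF a G]] E(2) by blast
qed

lemma compactin_fibre:
  assumes a: "a \<in> topspace pi0.ends"
  shows "compactin X (pi0.fibre a)"
proof (rule closed_compactin [OF compactin_limit_set])
  show "pi0.fibre a \<subseteq> limit_set X \<epsilon>"
    by (auto simp: pi0.fibre_def limit_set_def)
  show "closedin X (pi0.fibre a)"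
    unfolding fibre_eq_Inter_closure [OF a] using pi0.nonempty by (intro closedin_INT) auto
qed

text \<open>Inside the closure \<open>K\<close> of a small enough member of
  \<open>\<epsilon>\<close>, which is compact and Hausdorff, the fibre is a directed intersection of
  closed connected sets.\<close>

lemma continuum_fibre:
  assumes a: "a \<in> topspace pi0.ends" and H: "Hausdorff_at_infinity X \<epsilon>"
  shows "continuum_in X (pi0.fibre a)"
proof -
  obtain E0 E1 where E: "E0 \<in> \<epsilon>" "compactin X (X closure_of E0)"
      "E1 \<in> \<epsilon>" "Hausdorff_space (subtopology X (X closure_of E1))"
    using obtain_compact_closure H unfolding Hausdorff_at_infinity_def by metis
  define G where "G = E0 \<inter> E1"
  define K where "K = X closure_of G"
  let ?Y = "subtopology X K"
  \<comment> \<open>Only indices below \<open>G\<close> keep the closures inside \<open>K\<close>.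
    They are cofinal, through \<open>E \<inter> G\<close>, so the intersection is unchanged.\<close>
  let ?I = "{E \<in> \<epsilon>. E \<subseteq> G}"
  have G: "G \<in> \<epsilon>"
    unfolding G_def using pi0.directed E by blast
  have sub: "K \<subseteq> X closure_of E0" "K \<subseteq> X closure_of E1"
    by (simp_all add: K_def G_def closure_of_mono)
  have comp: "compact_space ?Y"
    using closed_compactin [OF E(2) sub(1)] by (simp add: K_def compact_space_subtopology)
  have haus: "Hausdorff_space ?Y"
    using Hausdorff_space_subtopology [OF E(4), of K] sub(2)
    by (simp add: subtopology_subtopology inf.absorb2)
  have inK: "X closure_of a E \<subseteq> K" if "E \<in> ?I" for E
    unfolding K_def using end_subset [OF a, of E] that by (intro closure_of_mono) auto
  have fib: "pi0.fibre a = (\<Inter>E\<in>?I. X closure_of a E)"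
  proof
    show "pi0.fibre a \<subseteq> (\<Inter>E\<in>?I. X closure_of a E)"
      by (auto simp: fibre_eq_Inter_closure [OF a])
    have "E \<inter> G \<in> ?I" "X closure_of a (E \<inter> G) \<subseteq> X closure_of a E" if "E \<in> \<epsilon>" for E
      using closure_end_directed [OF a that G] pi0.directed [OF that G] by auto
    then show "(\<Inter>E\<in>?I. X closure_of a E) \<subseteq> pi0.fibre a"
      unfolding fibre_eq_Inter_closure [OF a] by blast
  qed
  have "connectedin ?Y (\<Inter>E\<in>?I. X closure_of a E)"
  proof (rule connectedin_directed_Inter [OF comp haus])
    show "?I \<noteq> {}" using G by auto
    fix E assume E: "E \<in> ?I"
    show "closedin ?Y (X closure_of a E)"
      using inK [OF E] by (simp add: closedin_subset_topspace)
    obtain y where "a E = path_component_of_set (subtopology X E) y"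
      using pi0.end_class [OF a, of E] E by auto
    then have "connectedin X (a E)"
      using path_connectedin_path_component_of [of "subtopology X E" y]
      by (auto simp: path_connectedin_subtopology intro: path_connectedin_imp_connectedin)
    then show "connectedin ?Y (X closure_of a E)"
      using inK [OF E] by (simp add: connectedin_subtopology connectedin_closure_of)
  next
    fix E F assume EF: "E \<in> ?I" "F \<in> ?I"
    then show "\<exists>G\<in>?I. X closure_of a G \<subseteq> X closure_of a E \<inter> X closure_of a F"
      using closure_end_directed [OF a, of E F] pi0.directed [of E F]
      by (intro bexI [of _ "E \<inter> F"]) auto
  qed
  then have con: "connectedin X (pi0.fibre a)"
    by (simp add: fib connectedin_subtopology)
  have "pi0.fibre a \<subseteq> K"
    unfolding fib using inK G by blast
  then have "Hausdorff_space (subtopology X (pi0.fibre a))"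
    using Hausdorff_space_subtopology [OF haus, of "pi0.fibre a"]
    by (simp add: subtopology_subtopology inf.absorb2)
  with con compactin_fibre [OF a] show ?thesis
    by (simp add: continuum_in_def)
qed

section \<open>Compactness and profiniteness of the space of ends\<close>

lemma eval_pi0_image: "pi0.eval ` limit_set X \<epsilon> = topspace pi0.ends"
  using pi0.eval_image [OF fibre_nonempty] by (simp add: limit_set_def)

lemma compact_space_pi0_ends: "compact_space pi0.ends"
proof -
  have "compactin pi0.ends (pi0.eval ` limit_set X \<epsilon>)"
    using image_compactin [OF _ pi0.continuous_map_eval, of "limit_set X \<epsilon>"] compactin_limit_set
    by (simp add: compactin_subtopology limit_set_def)
  then show ?thesis
    by (simp add: eval_pi0_image compact_space_def)
qed

text \<open>The quotient is discrete: the preimage of a set \<open>V\<close> of path-components is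
  \<open>\<Union>V\<close>, a union of open sets.\<close>

lemma openin_quotient_path_components:
  assumes E: "E \<in> \<epsilon>" and V: "V \<subseteq> path_component_of_set (subtopology X E) ` E"
  shows "openin (quotient_topology (subtopology X E) (path_component_of_set (subtopology X E))) V"
proof -
  let ?Q = "path_component_of_set (subtopology X E)"
  have "{y \<in> E. ?Q y \<in> V} = \<Union>V"
  proof (intro set_eqI iffI)
    fix y assume "y \<in> {y \<in> E. ?Q y \<in> V}"
    then show "y \<in> \<Union>V"
      using pi0.class_refl [OF E, of y] by (intro UnionI [of "?Q y"]) auto
  next
    fix y assume "y \<in> \<Union>V"
    then obtain C where C: "C \<in> V" "y \<in> C" by (rule UnionE)
    then have "C \<in> ?Q ` E" using V by (intro subsetD [OF V])
    then have "?Q y = C" "y \<in> E"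
      using pi0.class_unique [OF E _ C(2)] pi0.class_subset [OF E] C(2) by fastforce+
    with C(1) show "y \<in> {y \<in> E. ?Q y \<in> V}" by simp
  qed
  moreover have "openin X (\<Union>V)"
    using V openin_path_component [OF E] by (intro openin_Union) auto
  moreover have "\<Union>V \<subseteq> E"
    using V pi0.class_subset [OF E] by blast
  ultimately show ?thesis
    using V ext_subset [OF E]
    by (simp add: openin_quotient_topology inf.absorb2 openin_open_subtopology open_ext [OF E])
qed

text \<open>Distinct ends differ at some \<open>E\<close>; there the singleton \<open>{a E}\<close>
  is clopen, and its preimage under the projection separates them.\<close>

lemma profinite_space_pi0_ends: "profinite_space pi0.ends"
proof (rule profinite_space_if_compact_separated [OF compact_space_pi0_ends])
  fix a b assume a: "a \<in> topspace pi0.ends" and b: "b \<in> topspace pi0.ends"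
    and "a \<noteq> b"
  have "a \<in> extensional \<epsilon>" "b \<in> extensional \<epsilon>"
    using a b by (simp_all add: pi0.topspace_ends)
  with \<open>a \<noteq> b\<close> obtain E where E: "E \<in> \<epsilon>" "a E \<noteq> b E"
    using extensionalityI by blast
  let ?Z = "quotient_topology (subtopology X E) (path_component_of_set (subtopology X E))"
  have cont: "continuous_map pi0.ends ?Z (\<lambda>a. a E)"
    by (rule pi0.continuous_map_ends_component [OF E(1)])
  have Z: "topspace ?Z = path_component_of_set (subtopology X E) ` E"
    by (rule pi0.topspace_quotient [OF E(1)])
  have "openin ?Z {a E}" "openin ?Z (topspace ?Z - {a E})"
    using openin_quotient_path_components [OF E(1)] Z pi0.end_class [OF a E(1)] by auto
  then have "openin ?Z {a E}" "closedin ?Z {a E}"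
    using Z pi0.end_class [OF a E(1)] by (auto simp: closedin_def)
  then have "openin pi0.ends {x \<in> topspace pi0.ends. x E \<in> {a E}}"
      "closedin pi0.ends {x \<in> topspace pi0.ends. x E \<in> {a E}}"
    using openin_continuous_map_preimage [OF cont] closedin_continuous_map_preimage [OF cont]
    by blast+
  then show "\<exists>U. openin pi0.ends U \<and> closedin pi0.ends U \<and> a \<in> U \<and> b \<notin> U"
    using a E(2) by (intro exI [of _ "{x \<in> topspace pi0.ends. x E \<in> {a E}}"]) auto
qed

end

section \<open>Transfer of the results to all four end spaces along the canonical maps\<close>

theorem theorem3p17:
  fixes X :: "'a topology" and \<epsilon> :: "'a set set"
  assumes "externology X \<epsilon>"
    and "locally_path_connected_space X"
    and "locally_compact_at_infinity X \<epsilon>"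
  shows
    \<comment> \<open>(i)\<close>
    "(limit_set X \<epsilon> = bar_limit_set X \<epsilon> \<and> compactin X (limit_set X \<epsilon>)) \<and>
    \<comment> \<open>the identification of the four end spaces along the canonical maps\<close>
     (homeomorphic_map (pi0_ends X \<epsilon>) (bar_pi0_ends X \<epsilon>) (pi0_to_bar_pi0 X \<epsilon>) \<and>
      homeomorphic_map (c_ends X \<epsilon>) (bar_c_ends X \<epsilon>) (c_to_bar_c X \<epsilon>) \<and>
      homeomorphic_map (pi0_ends X \<epsilon>) (c_ends X \<epsilon>) (pi0_to_c X \<epsilon>) \<and>
      homeomorphic_map (bar_pi0_ends X \<epsilon>) (bar_c_ends X \<epsilon>) (bar_pi0_to_bar_c X \<epsilon>) \<and>
      (\<forall>a\<in>topspace (pi0_ends X \<epsilon>).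
         bar_pi0_to_bar_c X \<epsilon> (pi0_to_bar_pi0 X \<epsilon> a) = c_to_bar_c X \<epsilon> (pi0_to_c X \<epsilon> a))) \<and>
    \<comment> \<open>(ii)\<close>
     (e0 X \<epsilon> ` limit_set X \<epsilon> = topspace (pi0_ends X \<epsilon>) \<and>
      bar_e0 X \<epsilon> ` bar_limit_set X \<epsilon> = topspace (bar_pi0_ends X \<epsilon>) \<and>
      e X \<epsilon> ` limit_set X \<epsilon> = topspace (c_ends X \<epsilon>) \<and>
      bar_e X \<epsilon> ` bar_limit_set X \<epsilon> = topspace (bar_c_ends X \<epsilon>) \<and>
      pi0_to_bar_pi0 X \<epsilon> ` (e0 X \<epsilon> ` limit_set X \<epsilon>) = bar_e0 X \<epsilon> ` bar_limit_set X \<epsilon> \<and>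
      c_to_bar_c X \<epsilon> ` (e X \<epsilon> ` limit_set X \<epsilon>) = bar_e X \<epsilon> ` bar_limit_set X \<epsilon> \<and>
      pi0_to_c X \<epsilon> ` (e0 X \<epsilon> ` limit_set X \<epsilon>) = e X \<epsilon> ` limit_set X \<epsilon> \<and>
      bar_pi0_to_bar_c X \<epsilon> ` (bar_e0 X \<epsilon> ` bar_limit_set X \<epsilon>) = bar_e X \<epsilon> ` bar_limit_set X \<epsilon>) \<and>
    \<comment> \<open>(iii)\<close>
     (profinite_space (pi0_ends X \<epsilon>) \<and> compact_space (pi0_ends X \<epsilon>) \<and>
      profinite_space (bar_pi0_ends X \<epsilon>) \<and> compact_space (bar_pi0_ends X \<epsilon>) \<and>
      profinite_space (c_ends X \<epsilon>) \<and> compact_space (c_ends X \<epsilon>) \<and>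
      profinite_space (bar_c_ends X \<epsilon>) \<and> compact_space (bar_c_ends X \<epsilon>)) \<and>
    \<comment> \<open>(iv)\<close>
     (\<forall>a\<in>topspace (pi0_ends X \<epsilon>).
        L_at X \<epsilon> (pi0_to_c X \<epsilon> a) = L0_at X \<epsilon> a \<and>
        bar_L0_at X \<epsilon> (pi0_to_bar_pi0 X \<epsilon> a) = L0_at X \<epsilon> a \<and>
        bar_L_at X \<epsilon> (bar_pi0_to_bar_c X \<epsilon> (pi0_to_bar_pi0 X \<epsilon> a)) = L0_at X \<epsilon> a \<and>
        L0_at X \<epsilon> a \<noteq> {} \<and>
        compactin X (L0_at X \<epsilon> a) \<and>
        (Hausdorff_at_infinity X \<epsilon> \<longrightarrow> continuum_in X (L0_at X \<epsilon> a)))"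
proof -
  interpret locally_compact_exterior_space X \<epsilon>
    using assms by unfold_locales
  have ends: "pi0_ends X \<epsilon> = pi0.ends" "bar_pi0_ends X \<epsilon> = bar_pi0.ends"
    "c_ends X \<epsilon> = c.ends" "bar_c_ends X \<epsilon> = bar_c.ends"
    unfolding pi0_ends_def bar_pi0_ends_def c_ends_def bar_c_ends_def
      pi0.ends_def bar_pi0.ends_def c.ends_def bar_c.ends_def
      pi0_space_def c_space_def pi0_map_def [abs_def] c_map_def [abs_def] by (rule refl)+
  have maps: "pi0_to_bar_pi0 X \<epsilon> = pi0_bar.fwd.lim_map" "c_to_bar_c X \<epsilon> = c_bar.fwd.lim_map"
    "pi0_to_c X \<epsilon> = pi0_c.fwd.lim_map" "bar_pi0_to_bar_c X \<epsilon> = bar_pi0_c.fwd.lim_map"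
    unfolding pi0_to_bar_pi0_def [abs_def] c_to_bar_c_def [abs_def] pi0_to_c_def [abs_def]
      bar_pi0_to_bar_c_def [abs_def] pi0_bar.fwd.lim_map_def [abs_def]
      c_bar.fwd.lim_map_def [abs_def] pi0_c.fwd.lim_map_def [abs_def]
      bar_pi0_c.fwd.lim_map_def [abs_def] pi0_map_def c_map_def by (rule refl)+
  have evals: "e0 X \<epsilon> = pi0.eval" "bar_e0 X \<epsilon> = bar_pi0.eval" "e X \<epsilon> = c.eval" "bar_e X \<epsilon> = bar_c.eval"
    unfolding e0_def [abs_def] bar_e0_def [abs_def] e_def [abs_def] bar_e_def [abs_def]
      pi0.eval_def [abs_def] bar_pi0.eval_def [abs_def] c.eval_def [abs_def]
      bar_c.eval_def [abs_def] by (rule refl)+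
  have fibres: "L0_at X \<epsilon> = pi0.fibre" "bar_L0_at X \<epsilon> = bar_pi0.fibre"
    "L_at X \<epsilon> = c.fibre" "bar_L_at X \<epsilon> = bar_c.fibre"
    unfolding L0_at_def [abs_def] bar_L0_at_def [abs_def] L_at_def [abs_def] bar_L_at_def [abs_def]
      evals limit_set_def bar_limit_set_def pi0.fibre_def [abs_def] bar_pi0.fibre_def [abs_def]
      c.fibre_def [abs_def] bar_c.fibre_def [abs_def] by (rule refl)+
  note homeo = pi0_bar.homeomorphic_map_lim_map c_bar.homeomorphic_map_lim_map
    pi0_c.homeomorphic_map_lim_map bar_pi0_c.homeomorphic_map_lim_map
  note images = homeo [THEN homeomorphic_imp_surjective_map]
  \<comment> \<open>For each \<open>E\<close> both routes around the square give a class containing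
    \<open>a E\<close>, so uniqueness applies.\<close>
  have commute: "bar_pi0_c.fwd.lim_map (pi0_bar.fwd.lim_map a) = c_bar.fwd.lim_map (pi0_c.fwd.lim_map a)"
    if a: "a \<in> topspace pi0.ends" for a
  proof (rule bar_pi0_c.fwd.lim_map_unique)
    show "pi0_bar.fwd.lim_map a \<in> topspace bar_pi0.ends"
      by (rule pi0_bar.fwd.lim_map_in_ends [OF a])
    have c: "pi0_c.fwd.lim_map a \<in> topspace c.ends"
      by (rule pi0_c.fwd.lim_map_in_ends [OF a])
    then show "c_bar.fwd.lim_map (pi0_c.fwd.lim_map a) \<in> topspace bar_c.ends"
      by (rule c_bar.fwd.lim_map_in_ends)
    show "pi0_bar.fwd.lim_map a E \<inter> c_bar.fwd.lim_map (pi0_c.fwd.lim_map a) E \<noteq> {}"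
      if E: "E \<in> \<epsilon>" for E
      using pi0_bar.fwd.lim_map_class(2) [OF a E] pi0_c.fwd.lim_map_class(2) [OF a E]
        c_bar.fwd.lim_map_class(2) [OF c E] pi0.class_nonempty [OF E pi0.end_class [OF a E]]
      by blast
  qed
  have fib: "bar_pi0.fibre (pi0_bar.fwd.lim_map a) = pi0.fibre a"
    "c.fibre (pi0_c.fwd.lim_map a) = pi0.fibre a"
    "bar_c.fibre (bar_pi0_c.fwd.lim_map (pi0_bar.fwd.lim_map a)) = pi0.fibre a"
    if "a \<in> topspace pi0.ends" for a
    using that bar_pi0_c.fibre_lim_map [OF pi0_bar.fwd.lim_map_in_ends [OF that]]
    by (simp_all add: pi0_bar.fibre_lim_map pi0_c.fibre_lim_map)
  \<comment> \<open>The canonical maps are onto and preserve fibres, so non-emptiness passes from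
    one system to the next.\<close>
  have ne: "bar_pi0.fibre b \<noteq> {}" if "b \<in> topspace bar_pi0.ends" for b
    using that fib(1) fibre_nonempty unfolding images(1) [symmetric] by auto
  have ne_c: "c.fibre b \<noteq> {}" if "b \<in> topspace c.ends" for b
    using that fib(2) fibre_nonempty unfolding images(3) [symmetric] by auto
  have ne_bar_c: "bar_c.fibre b \<noteq> {}" if "b \<in> topspace bar_c.ends" for b
    using that bar_pi0_c.fibre_lim_map ne unfolding images(4) [symmetric] by auto
  have surj: "bar_pi0.eval ` bar_limit_set X \<epsilon> = topspace bar_pi0.ends"
    "c.eval ` limit_set X \<epsilon> = topspace c.ends"
    "bar_c.eval ` bar_limit_set X \<epsilon> = topspace bar_c.ends"
    unfolding limit_set_def bar_limit_set_def
    using bar_pi0.eval_image [OF ne] c.eval_image [OF ne_c] bar_c.eval_image [OF ne_bar_c] by simp_all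
  have "pi0.ends homeomorphic_space bar_pi0.ends" "pi0.ends homeomorphic_space c.ends"
      "bar_pi0.ends homeomorphic_space bar_c.ends"
    using homeo homeomorphic_map_imp_homeomorphic_space by blast+
  then have hom: "S homeomorphic_space pi0.ends" if "S \<in> {bar_pi0.ends, c.ends, bar_c.ends}" for S
    using that homeomorphic_space_sym homeomorphic_space_trans by blast
  have prof: "profinite_space S" "compact_space S" if "S \<in> {bar_pi0.ends, c.ends, bar_c.ends}" for S
    using profinite_space_homeomorphic [OF profinite_space_pi0_ends hom [OF that]]
      homeomorphic_compact_space [OF hom [OF that]] compact_space_pi0_ends by blast+
  show ?thesis
    unfolding ends maps evals fibres eval_pi0_image surj images
    using limit_set_eq compactin_limit_set homeo commute profinite_space_pi0_ends
      compact_space_pi0_ends prof fib fibre_nonempty compactin_fibre continuum_fibre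
    by (intro conjI ballI impI refl) simp_all
qed

end
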